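(* Let $G$ be an $m$-uniform hypergraph containing at least one edge, and let $\mathcal{A}(G)$ be the adjacency tensor of $G$, with spectral radius $\rho$. (1) If $G$ is connected, then for all eigenvalues $\lambda$ of $\mathcal{A}(G)$ with modulus $\rho$, the projective eigenvarieties $\mathbb{V}_\lambda(\mathcal{A}(G))$ are finite and have the same number of elements; in particular there are finitely many eigenvectors of $\mathcal{A}(G)$ corresponding to $\lambda$ up to a scalar. (2) If $G$ is disconnected, then $\mathbb{V}_\rho(\mathcal{A}(G))$ has dimension greater than zero if and only if $G$ has at least two connected components on at least two vertices with spectral radius equal to $\rho$.
   Context: Let $m\ge 2$, $n\ge 1$, $[n]=\{1,\dots,n\}$. A tensor of order $m$ and dimension $n$ is an array $\mathcal{A}=(a_{i_1i_2\ldots i_m})$ of complex numbers indexed by $i_1,\dots,i_m\in[n]$. For $\mathbf{x}\in\mathbb{C}^n$, $\mathcal{A}\mathbf{x}^{m-1}\in\mathbb{C}^n$ is defined by $(\mathcal{A}\mathbf{x}^{m-1})_i=\sum_{i_2,\dots,i_m\in[n]}a_{ii_2\cdots i_m}x_{i_2}\cdots x_{i_m}$, and $\mathbf{x}^{[m-1]}=(x_1^{m-1},\dots,x_n^{m-1})$. A number $\lambda\in\mathbb{C}$ is an eigenvalue of $\mathcal{A}$ if $\mathcal{A}\mathbf{x}^{m-1}=\lambda\mathbf{x}^{[m-1]}$ for some nonzero $\mathbf{x}\in\mathbb{C}^n$, which is called an eigenvector corresponding to $\lambda$. The spectral radius is the largest modulus of an eigenvalue of $\mathcal{A}$ (for a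 tensor with nonnegative entries, the spectral radius is itself an eigenvalue). The projective eigenvariety associated with an eigenvalue $\lambda$ is $\mathbb{V}_\lambda(\mathcal{A})=\{\mathbf{x}\in\mathbb{P}^{n-1}:\mathcal{A}\mathbf{x}^{m-1}=\lambda\mathbf{x}^{[m-1]}\}$, where $\mathbb{P}^{n-1}$ is complex projective space. The dimension of a variety is its dimension as a Zariski topological space. An $m$-uniform hypergraph $G$ has a finite vertex set $V(G)=\{v_1,\dots,v_n\}$ and a set $E(G)$ of edges, each edge being a subset of $V(G)$ with exactly $m$ elements. Two vertices $u,w$ are connected if there is an alternating sequence of vertices and edges $v_0,e_1,v_1,e_2,\dots,e_l,v_l$ (here $v_0,\dots,v_l$ are vertices of $G$, not tied to the enumeration $V(G)=\{v_1,\dots,v_n\}$) with $u=v_0$, $w=v_l$ and $\{v_i,v_{i+1}\}\subseteq e_{i+1}$ for $i=0,\dots,l-1$. This is an equivalence relation; for each equivalence class $\alpha$, the connected component $G[\alpha]$ is the sub-hypergraph with vertex set $\alpha$ and edge set $\{e\in E(G):e\subseteq\alpha\}$. $G$ is connected if it has only one connected component, and disconnected otherwise. The adjacency tensor $\mathcal{A}(G)=(a_{i_1\ldots i_m})$ is the tensor of order $m$ and dimension $n$ with $a_{i_1\ldots i_m}=\frac{1}{(m-1)!}$ if $\{v_{i_1},\dots,v_{i_m}\}\in E(G)$, and $0$ otherwise. The spectral radius (and eigenvalues) of a hypergraph are those of its adjacency tensor. *)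

theory Defs
  imports "HOL-Analysis.Analysis" "HOL-Library.Poly_Mapping"
begin

section \<open>Complex projective space with its Zariski topology\<close>

text \<open>
  Coordinates are indexed by a finite set \<open>I\<close> instead of \<open>{1..n}\<close> (so \<open>n = card I\<close>).  Vectors are
  total functions that vanish outside \<open>I\<close>, so that equality of functions is equality of vectors.
\<close>

definition cvecs :: "'a set \<Rightarrow> ('a \<Rightarrow> complex) set" where
  "cvecs I = {x. \<forall>i. i \<notin> I \<longrightarrow> x i = 0}"

definition nonzero_cvecs :: "'a set \<Rightarrow> ('a \<Rightarrow> complex) set" where
  "nonzero_cvecs I = cvecs I - {\<lambda>_. 0}"

definition proj_rel :: "'a set \<Rightarrow> (('a \<Rightarrow> complex) \<times> ('a \<Rightarrow> complex)) set" where
  "proj_rel I = {(x, y). x \<in> nonzero_cvecs I \<and> y \<in> nonzero_cvecs I \<and>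
                         (\<exists>c. c \<noteq> 0 \<and> y = (\<lambda>i. c * x i))}"

definition proj_space :: "'a set \<Rightarrow> ('a \<Rightarrow> complex) set set" where
  "proj_space I = nonzero_cvecs I // proj_rel I"

lemma equiv_proj_rel: "equiv (nonzero_cvecs I) (proj_rel I)"
proof (rule equivI)
  show "proj_rel I \<subseteq> nonzero_cvecs I \<times> nonzero_cvecs I"
    by (auto simp: proj_rel_def)
  show "refl_on (nonzero_cvecs I) (proj_rel I)"
    by (auto simp: refl_on_def proj_rel_def intro!: exI[of _ "1::complex"])
  show "sym (proj_rel I)"
  proof (rule symI)
    fix x y assume "(x, y) \<in> proj_rel I"
    then obtain c where "x \<in> nonzero_cvecs I" "y \<in> nonzero_cvecs I" "c \<noteq> 0" "y = (\<lambda>i. c * x i)"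
      by (auto simp: proj_rel_def)
    then show "(y, x) \<in> proj_rel I"
      by (auto simp: proj_rel_def intro!: exI[of _ "inverse c"])
  qed
  show "trans (proj_rel I)"
  proof (rule transI)
    fix x y z assume "(x, y) \<in> proj_rel I" "(y, z) \<in> proj_rel I"
    then obtain c d where "x \<in> nonzero_cvecs I" "z \<in> nonzero_cvecs I"
      "c \<noteq> 0" "d \<noteq> 0" "y = (\<lambda>i. c * x i)" "z = (\<lambda>i. d * y i)"
      by (auto simp: proj_rel_def)
    then show "(x, z) \<in> proj_rel I"
      by (auto simp: proj_rel_def mult.assoc intro!: exI[of _ "d * c"])
  qed
qed

text \<open>
  Multivariate polynomials: a monomial is a finitely supported map from variables to exponents,
  a polynomial a finitely supported map from monomials to coefficients.
\<close>

type_synonym 'a mpoly_c = "('a \<Rightarrow>\<^sub>0 nat) \<Rightarrow>\<^sub>0 complex"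

definition monom_value :: "('a \<Rightarrow>\<^sub>0 nat) \<Rightarrow> ('a \<Rightarrow> complex) \<Rightarrow> complex" where
  "monom_value t x = (\<Prod>i\<in>Poly_Mapping.keys t. x i ^ Poly_Mapping.lookup t i)"

definition mpoly_value :: "'a mpoly_c \<Rightarrow> ('a \<Rightarrow> complex) \<Rightarrow> complex" where
  "mpoly_value p x = (\<Sum>t\<in>Poly_Mapping.keys p. Poly_Mapping.lookup p t * monom_value t x)"

definition homogeneous :: "'a set \<Rightarrow> nat \<Rightarrow> 'a mpoly_c \<Rightarrow> bool" where
  "homogeneous I d p \<longleftrightarrow> (\<forall>t\<in>Poly_Mapping.keys p.
     Poly_Mapping.keys t \<subseteq> I \<and> (\<Sum>i\<in>Poly_Mapping.keys t. Poly_Mapping.lookup t i) = d)"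

definition homogeneous_polys :: "'a set \<Rightarrow> 'a mpoly_c set" where
  "homogeneous_polys I = {p. \<exists>d. homogeneous I d p}"

definition zero_locus :: "'a set \<Rightarrow> 'a mpoly_c set \<Rightarrow> ('a \<Rightarrow> complex) set set" where
  "zero_locus I S = {P \<in> proj_space I. \<forall>p\<in>S. \<forall>x\<in>P. mpoly_value p x = 0}"

definition zariski :: "'a set \<Rightarrow> ('a \<Rightarrow> complex) set topology" where
  "zariski I = topology (\<lambda>U. U \<subseteq> proj_space I \<and>
     (\<exists>S \<subseteq> homogeneous_polys I. proj_space I - U = zero_locus I S))"

text \<open>
  The remaining facts of this section show that the sets used above do form a topology, so that
  \<^const>\<open>zariski\<close> really is the Zariski topology.
\<close>

lemma monom_value_superset:
  assumes "finite A" "Poly_Mapping.keys t \<subseteq> A"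
  shows "monom_value t x = (\<Prod>i\<in>A. x i ^ Poly_Mapping.lookup t i)"
  unfolding monom_value_def
  by (rule prod.mono_neutral_left) (use assms in \<open>auto simp: in_keys_iff\<close>)

lemma monom_value_add: "monom_value (s + t) x = monom_value s x * monom_value t x"
proof -
  let ?A = "Poly_Mapping.keys s \<union> Poly_Mapping.keys t"
  have "monom_value (s + t) x = (\<Prod>i\<in>?A. x i ^ Poly_Mapping.lookup (s + t) i)"
    by (rule monom_value_superset) (use keys_add[of s t] in auto)
  also have "\<dots> = (\<Prod>i\<in>?A. x i ^ Poly_Mapping.lookup s i) * (\<Prod>i\<in>?A. x i ^ Poly_Mapping.lookup t i)"
    by (simp add: lookup_add power_add prod.distrib)
  also have "\<dots> = monom_value s x * monom_value t x"
    by (simp add: monom_value_superset[of ?A, symmetric])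
  finally show ?thesis .
qed

lemma mpoly_value_superset:
  assumes "finite A" "Poly_Mapping.keys p \<subseteq> A"
  shows "mpoly_value p x = (\<Sum>t\<in>A. Poly_Mapping.lookup p t * monom_value t x)"
  unfolding mpoly_value_def
  by (rule sum.mono_neutral_left) (use assms in \<open>auto simp: in_keys_iff\<close>)

lemma mpoly_value_add: "mpoly_value (p + q) x = mpoly_value p x + mpoly_value q x"
proof -
  let ?A = "Poly_Mapping.keys p \<union> Poly_Mapping.keys q"
  have "mpoly_value (p + q) x = (\<Sum>t\<in>?A. Poly_Mapping.lookup (p + q) t * monom_value t x)"
    by (rule mpoly_value_superset) (use keys_add[of p q] in auto)
  also have "\<dots> = (\<Sum>t\<in>?A. Poly_Mapping.lookup p t * monom_value t x) + (\<Sum>t\<in>?A. Poly_Mapping.lookup q t * monom_value t x)"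
    by (simp add: lookup_add distrib_right sum.distrib)
  also have "\<dots> = mpoly_value p x + mpoly_value q x"
    by (simp add: mpoly_value_superset[of ?A, symmetric])
  finally show ?thesis .
qed

lemma mpoly_value_zero [simp]: "mpoly_value 0 x = 0"
  by (simp add: mpoly_value_def)

lemma mpoly_value_single: "mpoly_value (Poly_Mapping.single t a) x = a * monom_value t x"
  by (auto simp: mpoly_value_def)

lemma mpoly_value_sum: "mpoly_value (\<Sum>a\<in>A. f a) x = (\<Sum>a\<in>A. mpoly_value (f a) x)"
  by (induction A rule: infinite_finite_induct) (auto simp: mpoly_value_add)

lemma poly_mapping_sum_singles: "p = (\<Sum>t\<in>Poly_Mapping.keys p. Poly_Mapping.single t (Poly_Mapping.lookup p t))"
  by (rule poly_mapping_eqI)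
    (auto simp: lookup_sum lookup_single when_def in_keys_iff)

lemma mpoly_value_mult: "mpoly_value (p * q) x = mpoly_value p x * mpoly_value q x"
proof -
  have "p * q = (\<Sum>s\<in>Poly_Mapping.keys p. \<Sum>t\<in>Poly_Mapping.keys q. Poly_Mapping.single (s + t) (Poly_Mapping.lookup p s * Poly_Mapping.lookup q t))"
    by (subst poly_mapping_sum_singles[of p], subst poly_mapping_sum_singles[of q])
      (simp add: sum_product mult_single)
  then have "mpoly_value (p * q) x =
      (\<Sum>s\<in>Poly_Mapping.keys p. \<Sum>t\<in>Poly_Mapping.keys q. (Poly_Mapping.lookup p s * monom_value s x) * (Poly_Mapping.lookup q t * monom_value t x))"
    by (simp add: mpoly_value_sum mpoly_value_single monom_value_add mult_ac)
  then show ?thesis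
    by (simp add: mpoly_value_def sum_product)
qed

lemma mpoly_value_scale:
  assumes "homogeneous I d p"
  shows "mpoly_value p (\<lambda>i. c * x i) = c ^ d * mpoly_value p x"
proof -
  have "monom_value t (\<lambda>i. c * x i) = c ^ d * monom_value t x" if "t \<in> Poly_Mapping.keys p" for t
    using assms that
    by (auto simp: homogeneous_def monom_value_def power_mult_distrib prod.distrib
        power_sum[symmetric])
  then show ?thesis
    by (auto simp: mpoly_value_def sum_distrib_left intro!: sum.cong)
qed

lemma homogeneous_mult:
  assumes "homogeneous I d p" "homogeneous I e q"
  shows "homogeneous I (d + e) (p * q)"
  unfolding homogeneous_def
proof
  fix u assume "u \<in> Poly_Mapping.keys (p * q)"
  then obtain s t where st: "s \<in> Poly_Mapping.keys p" "t \<in> Poly_Mapping.keys q" "u = s + t"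
    using keys_mult[of p q] by blast
  let ?A = "Poly_Mapping.keys s \<union> Poly_Mapping.keys t"
  have sub: "Poly_Mapping.keys u \<subseteq> ?A"
    using st keys_add[of s t] by auto
  have *: "(\<Sum>i\<in>Poly_Mapping.keys v. Poly_Mapping.lookup v i) = (\<Sum>i\<in>?A. Poly_Mapping.lookup v i)" if "Poly_Mapping.keys v \<subseteq> ?A" for v :: "'a \<Rightarrow>\<^sub>0 nat"
    by (rule sum.mono_neutral_left) (use that in \<open>auto simp: in_keys_iff\<close>)
  have "(\<Sum>i\<in>Poly_Mapping.keys u. Poly_Mapping.lookup u i) = (\<Sum>i\<in>Poly_Mapping.keys s. Poly_Mapping.lookup s i) + (\<Sum>i\<in>Poly_Mapping.keys t. Poly_Mapping.lookup t i)"
    using *[OF sub] *[of s] *[of t] by (simp add: st(3) lookup_add sum.distrib)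
  moreover have "Poly_Mapping.keys u \<subseteq> I"
    using st sub assms unfolding homogeneous_def by blast
  ultimately show "Poly_Mapping.keys u \<subseteq> I \<and> sum (Poly_Mapping.lookup u) (Poly_Mapping.keys u) = d + e"
    using st assms by (simp add: homogeneous_def)
qed

lemma proj_space_rep_scale:
  assumes "P \<in> proj_space I" "x \<in> P" "y \<in> P"
  obtains c where "c \<noteq> 0" "y = (\<lambda>i. c * x i)"
proof -
  have "(x, y) \<in> proj_rel I"
    using assms equiv_proj_rel[of I] unfolding proj_space_def by (meson quotient_eq_iff)
  then show ?thesis
    using that by (auto simp: proj_rel_def)
qed

lemma zero_locus_Un:
  assumes "S \<subseteq> homogeneous_polys I" "T \<subseteq> homogeneous_polys I"
  shows "zero_locus I S \<union> zero_locus I T = zero_locus I {p * q |p q. p \<in> S \<and> q \<in> T}"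
    (is "_ = zero_locus I ?ST")
proof (intro equalityI subsetI)
  fix P assume "P \<in> zero_locus I S \<union> zero_locus I T"
  then show "P \<in> zero_locus I ?ST"
    by (fastforce simp: zero_locus_def mpoly_value_mult)
next
  fix P assume P: "P \<in> zero_locus I ?ST"
  then have PI: "P \<in> proj_space I" by (simp add: zero_locus_def)
  show "P \<in> zero_locus I S \<union> zero_locus I T"
  proof (cases "P \<in> zero_locus I S")
    case False
    then obtain p x where px: "p \<in> S" "x \<in> P" "mpoly_value p x \<noteq> 0"
      using PI by (auto simp: zero_locus_def)
    obtain d where d: "homogeneous I d p"
      using px assms by (auto simp: homogeneous_polys_def)
    have "mpoly_value q y = 0" if "q \<in> T" "y \<in> P" for q y
    proof -
      obtain c where "c \<noteq> 0" "y = (\<lambda>i. c * x i)"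
        using proj_space_rep_scale[OF PI px(2) \<open>y \<in> P\<close>] .
      then have "mpoly_value p y \<noteq> 0"
        using px d by (simp add: mpoly_value_scale)
      moreover have "mpoly_value (p * q) y = 0"
        using P px that unfolding zero_locus_def by blast
      ultimately show ?thesis
        by (simp add: mpoly_value_mult)
    qed
    then show ?thesis
      using PI by (auto simp: zero_locus_def)
  qed auto
qed

lemma istopology_zariski:
  "istopology (\<lambda>U. U \<subseteq> proj_space I \<and>
     (\<exists>S \<subseteq> homogeneous_polys I. proj_space I - U = zero_locus I S))"
  (is "istopology ?L")
  unfolding istopology_def
proof (intro conjI allI impI)
  fix U V assume U: "?L U" and V: "?L V"
  from U obtain S where S: "S \<subseteq> homogeneous_polys I" "proj_space I - U = zero_locus I S" by blast
  from V obtain T where T: "T \<subseteq> homogeneous_polys I" "proj_space I - V = zero_locus I T" by blast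
  let ?ST = "{p * q |p q. p \<in> S \<and> q \<in> T}"
  show "U \<inter> V \<subseteq> proj_space I" using U by blast
  show "\<exists>S \<subseteq> homogeneous_polys I. proj_space I - (U \<inter> V) = zero_locus I S"
  proof (intro exI conjI)
    show "?ST \<subseteq> homogeneous_polys I"
      using S(1) T(1) homogeneous_mult[of I] unfolding homogeneous_polys_def by blast
    show "proj_space I - (U \<inter> V) = zero_locus I ?ST"
      using zero_locus_Un[OF S(1) T(1)] S(2) T(2) by blast
  qed
next
  fix K assume K: "\<forall>U\<in>K. ?L U"
  then show "\<Union>K \<subseteq> proj_space I" by blast
  from K obtain S where S: "\<And>U. U \<in> K \<Longrightarrow> S U \<subseteq> homogeneous_polys I"
      "\<And>U. U \<in> K \<Longrightarrow> proj_space I - U = zero_locus I (S U)"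
    by metis
  show "\<exists>S \<subseteq> homogeneous_polys I. proj_space I - \<Union>K = zero_locus I S"
  proof (intro exI conjI)
    show "(\<Union>U\<in>K. S U) \<subseteq> homogeneous_polys I" using S(1) by blast
    have "zero_locus I (\<Union>U\<in>K. S U) = proj_space I \<inter> (\<Inter>U\<in>K. zero_locus I (S U))"
      unfolding zero_locus_def by blast
    also have "\<dots> = proj_space I \<inter> (\<Inter>U\<in>K. proj_space I - U)"
      using S(2) by simp
    finally show "proj_space I - \<Union>K = zero_locus I (\<Union>U\<in>K. S U)" by blast
  qed
qed

lemma openin_zariski:
  "openin (zariski I) U \<longleftrightarrow> U \<subseteq> proj_space I \<and>
     (\<exists>S \<subseteq> homogeneous_polys I. proj_space I - U = zero_locus I S)"
  by (simp add: zariski_def istopology_zariski)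

lemma topspace_zariski: "topspace (zariski I) = proj_space I"
proof
  show "topspace (zariski I) \<subseteq> proj_space I"
    by (auto simp: topspace_def openin_zariski)
  have one: "homogeneous I 0 1"
    by (auto simp: homogeneous_def)
  have "zero_locus I {1} = {}"
  proof -
    have "P \<noteq> {}" if "P \<in> proj_space I" for P
      using that in_quotient_imp_non_empty[OF equiv_proj_rel] by (auto simp: proj_space_def)
    moreover have "mpoly_value 1 x = 1" for x :: "'a \<Rightarrow> complex"
      using mpoly_value_single[of 0 1 x] by (simp add: monom_value_def)
    ultimately show ?thesis
      by (fastforce simp: zero_locus_def)
  qed
  then have "openin (zariski I) (proj_space I)"
    using one by (auto simp: openin_zariski homogeneous_polys_def intro!: exI[of _ "{1}"])
  then show "proj_space I \<subseteq> topspace (zariski I)"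
    by (rule openin_subset)
qed

section \<open>Dimension of a topological space\<close>

definition irreducible_in :: "'b topology \<Rightarrow> 'b set \<Rightarrow> bool" where
  "irreducible_in X Z \<longleftrightarrow> Z \<subseteq> topspace X \<and> Z \<noteq> {} \<and>
     (\<forall>A B. closedin X A \<and> closedin X B \<and> Z \<subseteq> A \<union> B \<longrightarrow> Z \<subseteq> A \<or> Z \<subseteq> B)"

text \<open>
  Supremum of the lengths of chains of irreducible closed sets; being taken in \<^typ>\<open>ereal\<close>,
  it is \<open>-\<infinity>\<close> for the empty space.
\<close>

definition space_dim :: "'b topology \<Rightarrow> ereal" where
  "space_dim X = Sup {ereal (real k) |k. \<exists>Z :: nat \<Rightarrow> 'b set.
     (\<forall>j\<le>k. closedin X (Z j) \<and> irreducible_in X (Z j)) \<and> (\<forall>j<k. Z j \<subset> Z (Suc j))}"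

definition variety_dim :: "'a set \<Rightarrow> ('a \<Rightarrow> complex) set set \<Rightarrow> ereal" where
  "variety_dim I V = space_dim (subtopology (zariski I) V)"

section \<open>Tensors and their eigenvalues\<close>

text \<open>
  A tensor of order \<open>m\<close> with index set \<open>I\<close> is a function on index lists; only its values on lists
  of length \<open>m\<close> with entries in \<open>I\<close> are used.
\<close>

type_synonym 'a tensor = "'a list \<Rightarrow> complex"

definition tensor_apply :: "nat \<Rightarrow> 'a set \<Rightarrow> 'a tensor \<Rightarrow> ('a \<Rightarrow> complex) \<Rightarrow> 'a \<Rightarrow> complex" where
  "tensor_apply m I A x i =
     (\<Sum>js | set js \<subseteq> I \<and> length js = m - 1. A (i # js) * (\<Prod>j\<leftarrow>js. x j))"

definition eigen_eq :: "nat \<Rightarrow> 'a set \<Rightarrow> 'a tensor \<Rightarrow> complex \<Rightarrow> ('a \<Rightarrow> complex) \<Rightarrow> bool" where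
  "eigen_eq m I A l x \<longleftrightarrow> (\<forall>i\<in>I. tensor_apply m I A x i = l * x i ^ (m - 1))"

definition eigenvectors :: "nat \<Rightarrow> 'a set \<Rightarrow> 'a tensor \<Rightarrow> complex \<Rightarrow> ('a \<Rightarrow> complex) set" where
  "eigenvectors m I A l = {x \<in> nonzero_cvecs I. eigen_eq m I A l x}"

definition eigenvalues :: "nat \<Rightarrow> 'a set \<Rightarrow> 'a tensor \<Rightarrow> complex set" where
  "eigenvalues m I A = {l. eigenvectors m I A l \<noteq> {}}"

definition spectral_radius :: "nat \<Rightarrow> 'a set \<Rightarrow> 'a tensor \<Rightarrow> real" where
  "spectral_radius m I A = (GREATEST r. r \<in> cmod ` eigenvalues m I A)"

definition proj_eigenvariety ::
    "nat \<Rightarrow> 'a set \<Rightarrow> 'a tensor \<Rightarrow> complex \<Rightarrow> ('a \<Rightarrow> complex) set set" where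
  "proj_eigenvariety m I A l = {P \<in> proj_space I. \<forall>x\<in>P. eigen_eq m I A l x}"

section \<open>Uniform hypergraphs\<close>

record 'a hypergraph =
  verts :: "'a set"
  edges :: "'a set set"

definition uniform_hypergraph :: "nat \<Rightarrow> 'a hypergraph \<Rightarrow> bool" where
  "uniform_hypergraph m G \<longleftrightarrow> finite (verts G) \<and> verts G \<noteq> {} \<and>
     (\<forall>e\<in>edges G. e \<subseteq> verts G \<and> card e = m)"

definition hyperwalk :: "'a hypergraph \<Rightarrow> 'a list \<Rightarrow> 'a set list \<Rightarrow> bool" where
  "hyperwalk G vs es \<longleftrightarrow> set vs \<subseteq> verts G \<and> set es \<subseteq> edges G \<and> length vs = Suc (length es) \<and>
     (\<forall>i<length es. {vs ! i, vs ! Suc i} \<subseteq> es ! i)"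

definition vert_connected_rel :: "'a hypergraph \<Rightarrow> ('a \<times> 'a) set" where
  "vert_connected_rel G = {(u, w). \<exists>vs es. hyperwalk G vs es \<and> hd vs = u \<and> last vs = w}"

definition induced_component :: "'a hypergraph \<Rightarrow> 'a set \<Rightarrow> 'a hypergraph" where
  "induced_component G \<alpha> = \<lparr>verts = \<alpha>, edges = {e \<in> edges G. e \<subseteq> \<alpha>}\<rparr>"

definition hypergraph_components :: "'a hypergraph \<Rightarrow> 'a hypergraph set" where
  "hypergraph_components G = induced_component G ` (verts G // vert_connected_rel G)"

definition connected_hypergraph :: "'a hypergraph \<Rightarrow> bool" where
  "connected_hypergraph G \<longleftrightarrow> card (hypergraph_components G) = 1"

text \<open>
  Tensor indices are the vertices themselves rather than their positions in an enumeration
  \<open>v\<^sub>1, \<dots>, v\<^sub>n\<close>; this makes the definition applicable to the components of a hypergraph as well.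
\<close>

definition adjacency_tensor :: "nat \<Rightarrow> 'a hypergraph \<Rightarrow> 'a tensor" where
  "adjacency_tensor m G is = (if set is \<in> edges G then 1 / fact (m - 1) else 0)"

abbreviation hg_spectral_radius :: "nat \<Rightarrow> 'a hypergraph \<Rightarrow> real" where
  "hg_spectral_radius m G \<equiv> spectral_radius m (verts G) (adjacency_tensor m G)"

abbreviation hg_eigenvalues :: "nat \<Rightarrow> 'a hypergraph \<Rightarrow> complex set" where
  "hg_eigenvalues m G \<equiv> eigenvalues m (verts G) (adjacency_tensor m G)"

abbreviation hg_eigenvectors :: "nat \<Rightarrow> 'a hypergraph \<Rightarrow> complex \<Rightarrow> ('a \<Rightarrow> complex) set" where
  "hg_eigenvectors m G l \<equiv> eigenvectors m (verts G) (adjacency_tensor m G) l"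

abbreviation hg_proj_eigenvariety ::
    "nat \<Rightarrow> 'a hypergraph \<Rightarrow> complex \<Rightarrow> ('a \<Rightarrow> complex) set set" where
  "hg_proj_eigenvariety m G l \<equiv> proj_eigenvariety m (verts G) (adjacency_tensor m G) l"

end

theory Submission
  imports Defs "HOL-Combinatorics.Multiset_Permutations"
begin

text \<open>
  The adjacency tensor is symmetric and nonnegative, so its spectral radius is a maximum: with
  \<open>f x\<close> the sum over all edges of the product of the coordinates of \<open>x\<close> on the edge, \<open>\<rho>\<close> is the
  largest value of \<open>m * f x / (\<Sum>i. x i ^ m)\<close> over nonnegative \<open>x \<noteq> 0\<close>.  A maximiser exists by
  compactness, the first order condition makes it an eigenvector for \<open>\<rho>\<close>, and the triangle
  inequality shows both that every eigenvalue has modulus at most \<open>\<rho>\<close> and that the moduli of the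
  coordinates of an eigenvector for an eigenvalue of modulus \<open>\<rho>\<close> form again a maximiser
  (\<open>extremal_link_sum\<close>, \<open>eigenvector_modulus\<close>).

  Let \<open>G\<close> be connected.  A maximiser with zero coordinates could be improved by raising them to a
  small \<open>t\<close>: some edge gains at least a multiple of \<open>t ^ (m - 1)\<close>, while the denominator only grows
  like \<open>t ^ m\<close>.  So maximisers are positive, and comparing coordinate ratios shows that they are
  unique up to scaling (\<open>extremal_pos\<close>, \<open>extremal_unique\<close>).  Hence an eigenvector for an eigenvalue
  \<open>l\<close> of modulus \<open>\<rho>\<close> is determined, up to a positive factor, by the phases \<open>u i\<close> of its coordinates.
  Equality in the triangle inequality turns the eigenvalue equation into one equation per edge \<open>e\<close>
  and vertex \<open>i \<in> e\<close>: the product of \<open>u\<close> over \<open>e\<close> equals \<open>(l / \<rho>) * u i ^ m\<close>.  In particular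
  \<open>u i ^ m\<close> is constant along edges, hence constant, so after normalising one phase to \<open>1\<close> only
  \<open>m\<close>-th roots of unity occur; this gives finiteness.  The equations are multiplicative in \<open>u\<close> and
  \<open>l / \<rho>\<close>, so multiplying coordinatewise by the quotient of the phases of two fixed eigenvectors for \<open>l'\<close>
  and \<open>l\<close> carries the eigenvectors for \<open>l\<close> injectively to those for \<open>l'\<close>; by symmetry the two
  eigenvarieties are equinumerous (\<open>twisted_eigenvector\<close>).

  Let \<open>G\<close> be arbitrary.  Restricting an eigenvector to a component gives zero or an eigenvector of
  the component, and an eigenvector of a component extended by zero is one of \<open>G\<close>.  If only one
  component attains \<open>\<rho>\<close>, all eigenvectors for \<open>\<rho>\<close> live on it and the eigenvariety is finite by the
  connected case; a finite set of projective points has dimension at most \<open>0\<close>, points being closed.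
  If two components attain \<open>\<rho>\<close>, with eigenvectors \<open>a\<close> and \<open>b\<close>, all vectors \<open>a + t * b\<close> are
  eigenvectors.  Their points form an irreducible set, since a polynomial restricted to a line
  vanishes identically or has finitely many zeros, and \<open>{[a]}\<close> is a proper subset of its closure;
  so the dimension is positive.  A component on one vertex has spectral radius \<open>0\<close> and never attains
  \<open>\<rho>\<close>, which is positive as soon as there is an edge.
\<close>

section \<open>The adjacency tensor as a sum over edges\<close>

text \<open>For the adjacency tensor \<open>A\<close>, \<open>m * edge_form G x\<close> is \<open>A x^m\<close> and \<open>link_sum G x i\<close> is the
  coordinate \<open>(A x^(m-1))_i\<close>.  The latter is polymorphic because nonnegative vectors are treated
  over the reals and eigenvectors over the complex numbers.\<close>

definition edge_form :: "'a hypergraph \<Rightarrow> ('a \<Rightarrow> real) \<Rightarrow> real" where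
  "edge_form G x = (\<Sum>e\<in>edges G. \<Prod>j\<in>e. x j)"

definition link_sum :: "'a hypergraph \<Rightarrow> ('a \<Rightarrow> 'b::comm_semiring_1) \<Rightarrow> 'a \<Rightarrow> 'b" where
  "link_sum G x i = (\<Sum>e | e \<in> edges G \<and> i \<in> e. \<Prod>j\<in>e - {i}. x j)"

text \<open>Connectedness as an induction principle: to prove that a property holds at every vertex,
  it suffices that it holds somewhere and spreads along edges.\<close>

definition indecomposable :: "'a hypergraph \<Rightarrow> bool" where
  "indecomposable G \<longleftrightarrow>
     (\<forall>S \<subseteq> verts G. S \<noteq> {} \<longrightarrow> (\<forall>e\<in>edges G. e \<inter> S \<noteq> {} \<longrightarrow> e \<subseteq> S) \<longrightarrow> S = verts G)"

locale uniform_hg =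
  fixes m :: nat and G :: "'a hypergraph"
  assumes m2: "m \<ge> 2" and uniform: "uniform_hypergraph m G"
begin

lemma finite_verts [simp]: "finite (verts G)"
  and verts_nonempty: "verts G \<noteq> {}"
  and edge_subset: "e \<in> edges G \<Longrightarrow> e \<subseteq> verts G"
  and card_edge: "e \<in> edges G \<Longrightarrow> card e = m"
  using uniform by (auto simp: uniform_hypergraph_def)

lemma finite_edges [simp]: "finite (edges G)"
  by (rule finite_subset[of _ "Pow (verts G)"]) (use edge_subset in auto)

lemma finite_edge: "e \<in> edges G \<Longrightarrow> finite e"
  using edge_subset finite_verts finite_subset by blast

lemma card_edge_minus: "e \<in> edges G \<Longrightarrow> i \<in> e \<Longrightarrow> card (e - {i}) = m - 1"
  by (simp add: card_edge finite_edge)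

lemma prod_edge_split:
  fixes x :: "'a \<Rightarrow> 'b::comm_semiring_1"
  assumes "e \<in> edges G" "i \<in> e"
  shows "(\<Prod>j\<in>e. x j) = x i * (\<Prod>j\<in>e - {i}. x j)"
  using assms by (simp add: finite_edge prod.remove)

text \<open>The attribute rewrites \<open>m - 1\<close> to \<open>m - Suc 0\<close>, the form in which the simplifier presents
  the exponent.\<close>

lemma power_m [simplified]: "a * a ^ (m - 1) = (a ^ m :: 'b::comm_semiring_1)"
  using m2 by (cases m) auto

text \<open>Every edge through \<open>i\<close> is met once for each ordering of its other vertices, which
  cancels the factor \<open>1 / (m - 1)!\<close>.\<close>

lemma tensor_apply_adjacency:
  "tensor_apply m (verts G) (adjacency_tensor m G) x i = link_sum G x i"
proof -
  let ?L = "{js. set js \<subseteq> verts G \<and> length js = m - 1}"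
  let ?E = "{e. e \<in> edges G \<and> i \<in> e}"
  let ?w = "\<lambda>js. 1 / fact (m - 1) * (\<Prod>j\<leftarrow>js. x j)"
  have finL: "finite ?L"
    by (rule finite_lists_length_eq) simp
  have finE: "finite ?E" by simp
  have perm: "{js \<in> ?L. insert i (set js) = e} = permutations_of_set (e - {i})" if "e \<in> ?E" for e
  proof (intro equalityI subsetI)
    fix js assume js: "js \<in> {js \<in> ?L. insert i (set js) = e}"
    have e: "e \<in> edges G" "i \<in> e" using that by auto
    have le: "card (set js) \<le> m - 1" using js card_length[of js] by auto
    have c: "card (insert i (set js)) = m" using js card_edge[OF e(1)] by simp
    have ni: "i \<notin> set js"
    proof
      assume "i \<in> set js"
      then have "m \<le> m - 1" using c le by (simp add: insert_absorb)
      then show False using m2 by simp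
    qed
    then have "card (set js) = length js" using c js by auto
    then have "distinct js" by (rule card_distinct)
    then show "js \<in> permutations_of_set (e - {i})" using js ni by (auto simp: permutations_of_set_def)
  next
    fix js assume js: "js \<in> permutations_of_set (e - {i})"
    have e: "e \<in> edges G" "i \<in> e" using that by auto
    have "set js = e - {i}" "distinct js" using js by (auto simp: permutations_of_set_def)
    moreover from this have "length js = m - 1"
      using card_edge_minus[OF e] distinct_card[of js] by simp
    ultimately show "js \<in> {js \<in> ?L. insert i (set js) = e}"
      using e edge_subset[OF e(1)] by auto
  qed
  have "tensor_apply m (verts G) (adjacency_tensor m G) x i
      = (\<Sum>js\<in>?L. \<Sum>e\<in>?E. if insert i (set js) = e then ?w js else 0)"
    unfolding tensor_apply_def
  proof (rule sum.cong)
    fix js assume "js \<in> ?L"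
    have "(\<Sum>e\<in>?E. if insert i (set js) = e then ?w js else 0) =
        (if insert i (set js) \<in> ?E then ?w js else 0)"
      by (rule sum.delta') (rule finE)
    then show "adjacency_tensor m G (i # js) * (\<Prod>j\<leftarrow>js. x j) =
        (\<Sum>e\<in>?E. if insert i (set js) = e then ?w js else 0)"
      by (simp add: adjacency_tensor_def)
  qed auto
  also have "\<dots> = (\<Sum>e\<in>?E. \<Sum>js\<in>?L. if insert i (set js) = e then ?w js else 0)"
    by (rule sum.swap)
  also have "\<dots> = (\<Sum>e\<in>?E. \<Prod>j\<in>e - {i}. x j)"
  proof (rule sum.cong)
    fix e assume e: "e \<in> ?E"
    have "(\<Sum>js\<in>?L. if insert i (set js) = e then ?w js else 0) =
        (\<Sum>js\<in>{js \<in> ?L. insert i (set js) = e}. ?w js)"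
      by (rule sum.inter_filter[OF finL, symmetric])
    also have "\<dots> = (\<Sum>js\<in>permutations_of_set (e - {i}). ?w js)"
      by (simp only: perm[OF e])
    also have "\<dots> = (\<Sum>js\<in>permutations_of_set (e - {i}). 1 / fact (m - 1) * (\<Prod>j\<in>e - {i}. x j))"
      by (rule sum.cong)
        (auto simp: permutations_of_set_def prod.distinct_set_conv_list[symmetric])
    also have "\<dots> = (\<Prod>j\<in>e - {i}. x j)"
      using e card_edge_minus[of e i] by (simp add: finite_edge del: card_Diff_insert card_Diff_singleton_if)
    finally show "(\<Sum>js\<in>?L. if insert i (set js) = e then ?w js else 0) = (\<Prod>j\<in>e - {i}. x j)" .
  qed auto
  finally show ?thesis by (simp add: link_sum_def)
qed

lemma eigen_eq_adjacency:
  "eigen_eq m (verts G) (adjacency_tensor m G) l x \<longleftrightarrow>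
     (\<forall>i\<in>verts G. link_sum G x i = l * x i ^ (m - 1))"
  by (simp add: eigen_eq_def tensor_apply_adjacency)

text \<open>Euler's identity for the homogeneous form: each edge is counted once for each of its \<open>m\<close>
  vertices.\<close>

lemma euler_edge_form:
  fixes x :: "'a \<Rightarrow> real"
  shows "(\<Sum>i\<in>verts G. x i * link_sum G x i) = real m * edge_form G x"
proof -
  have "(\<Sum>i\<in>verts G. x i * link_sum G x i) =
      (\<Sum>i\<in>verts G. \<Sum>e | e \<in> edges G \<and> i \<in> e. \<Prod>j\<in>e. x j)"
    by (rule sum.cong[OF refl])
      (auto simp: link_sum_def sum_distrib_left prod_edge_split intro!: sum.cong)
  also have "\<dots> = (\<Sum>e\<in>edges G. \<Sum>i | i \<in> verts G \<and> i \<in> e. \<Prod>j\<in>e. x j)"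
    by (rule sum.swap_restrict) auto
  also have "\<dots> = (\<Sum>e\<in>edges G. real m * (\<Prod>j\<in>e. x j))"
  proof (rule sum.cong[OF refl])
    fix e assume e: "e \<in> edges G"
    have "{i \<in> verts G. i \<in> e} = e" using edge_subset[OF e] by auto
    then show "(\<Sum>i | i \<in> verts G \<and> i \<in> e. \<Prod>j\<in>e. x j) = real m * (\<Prod>j\<in>e. x j)"
      using card_edge[OF e] by simp
  qed
  finally show ?thesis by (simp add: edge_form_def sum_distrib_left)
qed

lemma link_sum_scale:
  fixes x :: "'a \<Rightarrow> 'b::comm_semiring_1"
  shows "link_sum G (\<lambda>j. c * x j) i = c ^ (m - 1) * link_sum G x i"
  unfolding link_sum_def sum_distrib_left
  by (rule sum.cong) (auto simp: prod.distrib finite_edge card_edge)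

lemma link_sum_cong:
  assumes "\<And>e j. e \<in> edges G \<Longrightarrow> i \<in> e \<Longrightarrow> j \<in> e \<Longrightarrow> x j = y j"
  shows "link_sum G x i = link_sum G y i"
  unfolding link_sum_def using assms by (intro sum.cong prod.cong) auto

lemma link_sum_zero:
  fixes x :: "'a \<Rightarrow> 'b::comm_semiring_1"
  assumes "\<And>e j. e \<in> edges G \<Longrightarrow> i \<in> e \<Longrightarrow> j \<in> e \<Longrightarrow> x j = 0"
  shows "link_sum G x i = 0"
proof -
  have "link_sum G x i = link_sum G (\<lambda>j. 0 * x j) i"
    by (rule link_sum_cong) (use assms in auto)
  also have "\<dots> = 0" unfolding link_sum_scale using m2 by (simp add: power_0_left)
  finally show ?thesis .
qed

lemma link_sum_of_real: "link_sum G (\<lambda>j. complex_of_real (x j)) i = of_real (link_sum G x i)"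
  by (simp add: link_sum_def)

lemma norm_link_sum_le: "cmod (link_sum G y i) \<le> link_sum G (\<lambda>j. cmod (y j)) i"
  unfolding link_sum_def by (rule order_trans[OF norm_sum]) (simp add: prod_norm)

lemma link_sum_nonneg:
  fixes x :: "'a \<Rightarrow> real"
  assumes "\<And>j. j \<in> verts G \<Longrightarrow> 0 \<le> x j"
  shows "0 \<le> link_sum G x i"
  unfolding link_sum_def using assms edge_subset by (intro sum_nonneg prod_nonneg) blast

lemma edge_form_nonneg:
  assumes "\<And>j. j \<in> verts G \<Longrightarrow> 0 \<le> x j"
  shows "0 \<le> edge_form G x"
  unfolding edge_form_def using assms edge_subset by (intro sum_nonneg prod_nonneg) blast

lemma edge_form_scale: "edge_form G (\<lambda>j. c * x j) = c ^ m * edge_form G x"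
  unfolding edge_form_def sum_distrib_left by (rule sum.cong) (auto simp: prod.distrib card_edge)

lemma edge_form_cong:
  assumes "\<And>j. j \<in> verts G \<Longrightarrow> x j = y j"
  shows "edge_form G x = edge_form G y"
  unfolding edge_form_def using assms edge_subset by (intro sum.cong prod.cong) blast+

section \<open>The spectral radius as a maximum\<close>

text \<open>Extremal vectors are the maximisers of \<open>m * edge_form G x / (\<Sum>i. x i ^ m)\<close> among nonnegative
  nonzero vectors, and \<open>r\<close> is the maximum.  The quotient is cleared of denominators, so that no
  normalisation has to be maintained.\<close>

definition form_bound :: "real \<Rightarrow> bool" where
  "form_bound r \<longleftrightarrow> (\<forall>y. (\<forall>i\<in>verts G. 0 \<le> y i) \<longrightarrow>
     real m * edge_form G y \<le> r * (\<Sum>i\<in>verts G. y i ^ m))"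

definition extremal :: "real \<Rightarrow> ('a \<Rightarrow> real) \<Rightarrow> bool" where
  "extremal r x \<longleftrightarrow> form_bound r \<and> (\<forall>i\<in>verts G. 0 \<le> x i) \<and> (\<exists>i\<in>verts G. x i \<noteq> 0) \<and>
     real m * edge_form G x = r * (\<Sum>i\<in>verts G. x i ^ m)"

lemma sum_powers_pos:
  assumes "\<And>i. i \<in> verts G \<Longrightarrow> 0 \<le> (x i :: real)" "k \<in> verts G" "x k \<noteq> 0"
  shows "0 < (\<Sum>i\<in>verts G. x i ^ m)"
proof (rule sum_pos2[of _ k])
  show "0 < x k ^ m" using assms(1)[OF assms(2)] assms(3) by simp
qed (use assms in auto)

text \<open>Both sides of the bound are homogeneous of degree \<open>m\<close>, so it suffices to maximise over the
  nonnegative part of the unit sphere of the \<open>m\<close>-norm.  Fixing the coordinates outside the vertex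
  set to \<open>0\<close> makes this set compact in the product topology.\<close>

lemma exists_extremal: "\<exists>r x. extremal r x"
proof -
  let ?V = "verts G"
  define K where "K = PiE UNIV (\<lambda>i. if i \<in> ?V then {0..1} else {0::real}) \<inter> {x. (\<Sum>i\<in>?V. x i ^ m) = 1}"
  have coord: "continuous_on UNIV (\<lambda>x::'a \<Rightarrow> real. x i)" for i
    by simp
  have "compactin (product_topology (\<lambda>i. euclidean) UNIV) (PiE UNIV (\<lambda>i. if i \<in> ?V then {0..1} else {0::real}))"
    by (subst compactin_PiE) auto
  then have "compact (PiE UNIV (\<lambda>i. if i \<in> ?V then {0..1} else {0::real}))"
    by (simp add: euclidean_product_topology)
  moreover have "closed {x::'a \<Rightarrow> real. (\<Sum>i\<in>?V. x i ^ m) = 1}"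
    by (intro closed_Collect_eq continuous_intros coord)
  ultimately have "compact K"
    unfolding K_def by (rule compact_Int_closed)
  moreover have "K \<noteq> {}"
  proof -
    obtain v where v: "v \<in> ?V" using verts_nonempty by auto
    have "(\<Sum>i\<in>?V. (if i = v then 1 else 0::real) ^ m) = (\<Sum>i\<in>?V. if i = v then 1 else 0)"
      using m2 by (intro sum.cong) (auto simp: power_0_left)
    also have "\<dots> = 1" using v by simp
    finally have "(\<lambda>i. if i = v then 1 else 0) \<in> K"
      using v by (auto simp: K_def)
    then show ?thesis by blast
  qed
  moreover have "continuous_on K (edge_form G)"
    unfolding edge_form_def
    by (intro continuous_intros continuous_on_subset[OF coord]) auto
  ultimately obtain x where x: "x \<in> K" and max: "\<And>y. y \<in> K \<Longrightarrow> edge_form G y \<le> edge_form G x"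
    using continuous_attains_sup[of K "edge_form G"] by blast
  have x01: "i \<in> ?V \<Longrightarrow> x i \<in> {0..1}" for i
    using x by (auto simp: K_def PiE_iff split: if_splits)
  have sx: "(\<Sum>i\<in>?V. x i ^ m) = 1" using x by (simp add: K_def)
  have nz: "\<exists>i\<in>?V. x i \<noteq> 0"
  proof (rule ccontr)
    assume "\<not> ?thesis"
    then have "(\<Sum>i\<in>?V. x i ^ m) = 0" using m2 by (auto simp: power_0_left)
    then show False using sx by simp
  qed
  have "form_bound (real m * edge_form G x)"
    unfolding form_bound_def
  proof (intro allI impI)
    fix y :: "'a \<Rightarrow> real" assume y: "\<forall>i\<in>?V. 0 \<le> y i"
    let ?s = "\<Sum>i\<in>?V. y i ^ m"
    show "real m * edge_form G y \<le> real m * edge_form G x * ?s"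
    proof (cases "\<exists>k\<in>?V. y k \<noteq> 0")
      case False
      have "edge_form G y = edge_form G (\<lambda>j. 0 * y j)"
        by (rule edge_form_cong) (use False in auto)
      also have "\<dots> = 0" unfolding edge_form_scale using m2 by (simp add: power_0_left)
      finally have "edge_form G y = 0" .
      moreover have "?s = 0" using False m2 by (auto simp: power_0_left)
      ultimately show ?thesis by simp
    next
      case True
      then have s: "?s > 0" using sum_powers_pos y by blast
      \<comment> \<open>The factor that scales \<open>y\<close> to the unit sphere.\<close>
      define c where "c = inverse (root m ?s)"
      have c: "c > 0" "c ^ m = inverse ?s"
        using s m2 by (auto simp: c_def power_inverse)
      define z where "z i = (if i \<in> ?V then c * y i else 0)" for i
      have sz: "(\<Sum>i\<in>?V. z i ^ m) = 1"
        using s by (simp add: z_def power_mult_distrib c(2) flip: sum_distrib_left)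
      have z0: "0 \<le> z i" for i using y c by (auto simp: z_def)
      have "z i \<le> 1" if "i \<in> ?V" for i
      proof -
        have "z i ^ m \<le> (\<Sum>i\<in>?V. z i ^ m)"
          using that z0 by (intro member_le_sum) auto
        then have "z i ^ m \<le> 1 ^ m" using sz by simp
        then show ?thesis using m2 power_mono_iff[of "z i" 1 m] z0 by auto
      qed
      then have "z \<in> K" using z0 sz by (auto simp: K_def PiE_iff) (simp add: z_def)
      then have "edge_form G z \<le> edge_form G x" by (rule max)
      moreover have "edge_form G z = c ^ m * edge_form G y"
        unfolding edge_form_scale[symmetric] by (rule edge_form_cong) (simp add: z_def)
      ultimately have "edge_form G y \<le> edge_form G x * ?s"
        using s c by (simp add: field_simps)
      then show ?thesis using m2 by (simp add: mult.assoc)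
    qed
  qed
  then have "extremal (real m * edge_form G x) x"
    unfolding extremal_def using x01 nz sx by simp
  then show ?thesis by blast
qed

text \<open>An edge contains a vertex at most once, so the form is affine in each single coordinate.\<close>

lemma edge_form_update:
  "edge_form G (x(i := x i + t)) = edge_form G x + t * link_sum G x i"
proof -
  have "(\<Prod>j\<in>e. (x(i := x i + t)) j) = (\<Prod>j\<in>e. x j) + t * (if i \<in> e then \<Prod>j\<in>e - {i}. x j else 0)"
    if e: "e \<in> edges G" for e
  proof (cases "i \<in> e")
    case True
    have "(\<Prod>j\<in>e - {i}. (x(i := x i + t)) j) = (\<Prod>j\<in>e - {i}. x j)"
      by (rule prod.cong) auto
    then show ?thesis
      using True by (simp add: prod_edge_split[OF e True] distrib_right)
  next
    case False
    then show ?thesis by (auto intro!: prod.cong)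
  qed
  then have "edge_form G (x(i := x i + t)) =
      (\<Sum>e\<in>edges G. (\<Prod>j\<in>e. x j) + t * (if i \<in> e then \<Prod>j\<in>e - {i}. x j else 0))"
    unfolding edge_form_def by (rule sum.cong[OF refl])
  then show ?thesis
    by (simp add: sum.distrib edge_form_def link_sum_def sum_distrib_left[symmetric] sum.inter_filter)
qed

lemma extremal_nonneg_value:
  assumes "extremal r x" shows "0 \<le> r"
proof -
  have "0 < (\<Sum>i\<in>verts G. x i ^ m)" using assms sum_powers_pos unfolding extremal_def by blast
  moreover have "0 \<le> r * (\<Sum>i\<in>verts G. x i ^ m)"
    using assms edge_form_nonneg[of x] unfolding extremal_def by (metis mult_nonneg_nonneg of_nat_0_le_iff)
  ultimately show ?thesis by (simp add: zero_le_mult_iff)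
qed

text \<open>Raising the coordinate \<open>x i\<close> by \<open>t > 0\<close> stays within the nonnegative vectors, and letting
  \<open>t\<close> tend to \<open>0\<close> gives \<open>link_sum G x i \<le> r * x i ^ (m - 1)\<close>.  Weighted with \<open>x i\<close> and summed, these
  inequalities become an equality by Euler's identity, so each of them is an equality where
  \<open>x i > 0\<close>; where \<open>x i = 0\<close>, the left side lies between \<open>0\<close> and \<open>0\<close>.  Using increments of one sign
  only avoids treating the boundary of the nonnegative orthant separately.\<close>

lemma extremal_link_sum:
  assumes ex: "extremal r x" and i: "i \<in> verts G"
  shows "link_sum G x i = r * x i ^ (m - 1)"
proof -
  let ?V = "verts G"
  have x0: "\<And>i. i \<in> ?V \<Longrightarrow> 0 \<le> x i" using ex by (auto simp: extremal_def)
  have le: "link_sum G x i \<le> r * x i ^ (m - 1)" if i: "i \<in> ?V" for i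
  proof -
    have "real m * link_sum G x i \<le> r * (((x i + t) ^ m - x i ^ m) / t)" if t: "t > 0" for t
    proof -
      let ?y = "x(i := x i + t)"
      have "\<forall>k\<in>?V. 0 \<le> ?y k" using x0 t i by auto
      then have "real m * edge_form G ?y \<le> r * (\<Sum>k\<in>?V. ?y k ^ m)"
        using ex unfolding extremal_def form_bound_def by blast
      moreover have "(\<Sum>k\<in>?V. ?y k ^ m) = (\<Sum>k\<in>?V. x k ^ m) + ((x i + t) ^ m - x i ^ m)"
      proof -
        have "(\<Sum>k\<in>?V - {i}. ?y k ^ m) = (\<Sum>k\<in>?V - {i}. x k ^ m)" by (rule sum.cong) auto
        then show ?thesis
          using i by (simp add: sum.remove[of ?V i])
      qed
      ultimately have "real m * (t * link_sum G x i) \<le> r * ((x i + t) ^ m - x i ^ m)"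
        using ex by (simp add: edge_form_update extremal_def distrib_left)
      then show ?thesis using t by (simp add: field_simps)
    qed
    then have ev: "\<forall>\<^sub>F t in at_right 0. real m * link_sum G x i \<le> r * (((x i + t) ^ m - x i ^ m) / t)"
      by (simp add: eventually_at_right_less eventually_mono[OF eventually_at_right_less])
    have "((\<lambda>t. ((x i + t) ^ m - x i ^ m) / t) \<longlongrightarrow> real m * x i ^ (m - Suc 0)) (at 0)"
      using DERIV_pow[of m "x i" UNIV] unfolding DERIV_def by simp
    then have "((\<lambda>t. r * (((x i + t) ^ m - x i ^ m) / t)) \<longlongrightarrow> r * (real m * x i ^ (m - 1))) (at_right 0)"
      by (intro tendsto_intros) (auto simp: filterlim_at_split)
    from tendsto_lowerbound[OF this ev] have "real m * link_sum G x i \<le> real m * (r * x i ^ (m - 1))"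
      by (simp add: mult_ac)
    then show ?thesis using m2 by simp
  qed
  have "(\<Sum>i\<in>?V. x i * (r * x i ^ (m - 1) - link_sum G x i)) = 0"
  proof -
    have "(\<Sum>i\<in>?V. x i * (r * x i ^ (m - 1) - link_sum G x i)) =
        (\<Sum>i\<in>?V. r * (x i * x i ^ (m - 1))) - (\<Sum>i\<in>?V. x i * link_sum G x i)"
      by (simp add: right_diff_distrib sum_subtractf mult_ac)
    also have "\<dots> = 0"
      using ex by (simp add: power_m euler_edge_form extremal_def flip: sum_distrib_left)
    finally show ?thesis .
  qed
  then have "x i * (r * x i ^ (m - 1) - link_sum G x i) = 0"
    using x0 le i by (subst (asm) sum_nonneg_eq_0_iff) auto
  then show ?thesis
    using le[OF i] link_sum_nonneg[of x i] x0 m2 by (auto simp: power_0_left)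
qed

lemma extremal_eigenvector:
  assumes ex: "extremal r x"
  shows "(\<lambda>i. if i \<in> verts G then complex_of_real (x i) else 0) \<in> hg_eigenvectors m G (of_real r)"
    (is "?x \<in> _")
proof -
  have "link_sum G ?x i = of_real r * ?x i ^ (m - 1)" if "i \<in> verts G" for i
  proof -
    have "link_sum G ?x i = link_sum G (\<lambda>i. complex_of_real (x i)) i"
      by (rule link_sum_cong) (use edge_subset in auto)
    then show ?thesis using that by (simp add: link_sum_of_real extremal_link_sum[OF ex])
  qed
  moreover have "?x \<in> nonzero_cvecs (verts G)"
    using ex by (fastforce simp: nonzero_cvecs_def cvecs_def extremal_def fun_eq_iff)
  ultimately show ?thesis by (simp add: eigenvectors_def eigen_eq_adjacency)
qed

lemma eigenvectorsD:
  assumes "y \<in> hg_eigenvectors m G l"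
  shows "i \<in> verts G \<Longrightarrow> link_sum G y i = l * y i ^ (m - 1)"
    and "\<exists>i\<in>verts G. y i \<noteq> 0" and "i \<notin> verts G \<Longrightarrow> y i = 0"
  using assms by (auto simp: eigenvectors_def eigen_eq_adjacency nonzero_cvecs_def cvecs_def fun_eq_iff)

lemma eigenvectorsI:
  assumes "\<And>i. i \<in> verts G \<Longrightarrow> link_sum G y i = l * y i ^ (m - 1)"
    and "k \<in> verts G" "y k \<noteq> 0" and "\<And>i. i \<notin> verts G \<Longrightarrow> y i = 0"
  shows "y \<in> hg_eigenvectors m G l"
  using assms by (auto simp: eigenvectors_def eigen_eq_adjacency nonzero_cvecs_def cvecs_def fun_eq_iff)

text \<open>Take moduli in the eigenvalue equation, multiply by \<open>cmod (y i)\<close> and sum: Euler's identity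
  bounds \<open>cmod l * (\<Sum>i. cmod (y i) ^ m)\<close> by the form at the vector of moduli.\<close>

lemma eigenvector_modulus:
  assumes b: "form_bound r" and y: "y \<in> hg_eigenvectors m G l"
  shows "cmod l \<le> r" and "cmod l = r \<Longrightarrow> extremal r (\<lambda>i. cmod (y i))"
proof -
  let ?V = "verts G" and ?a = "\<lambda>i. cmod (y i)"
  obtain k where k: "k \<in> ?V" "y k \<noteq> 0" using eigenvectorsD(2)[OF y] by blast
  have s: "0 < (\<Sum>i\<in>?V. ?a i ^ m)" by (rule sum_powers_pos[of _ k]) (use k in auto)
  have "cmod l * (\<Sum>i\<in>?V. ?a i ^ m) = (\<Sum>i\<in>?V. ?a i * cmod (link_sum G y i))"
    by (auto simp: sum_distrib_left eigenvectorsD(1)[OF y] norm_mult norm_power mult.left_commute[of _ "cmod l"] power_m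
        intro!: sum.cong)
  also have "\<dots> \<le> (\<Sum>i\<in>?V. ?a i * link_sum G ?a i)"
    by (intro sum_mono mult_left_mono norm_link_sum_le) auto
  also have "\<dots> = real m * edge_form G ?a" by (rule euler_edge_form)
  finally have 1: "cmod l * (\<Sum>i\<in>?V. ?a i ^ m) \<le> real m * edge_form G ?a" .
  have 2: "real m * edge_form G ?a \<le> r * (\<Sum>i\<in>?V. ?a i ^ m)"
    using b by (simp add: form_bound_def)
  from 1 2 s show "cmod l \<le> r" by (meson mult_le_cancel_right_pos order_trans)
  show "extremal r ?a" if "cmod l = r"
    unfolding extremal_def using b 1 2 that k by force
qed

lemma extremal_spectral_radius:
  assumes ex: "extremal r x" shows "hg_spectral_radius m G = r"
proof -
  have b: "form_bound r" using ex by (simp add: extremal_def)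
  have "r \<in> cmod ` hg_eigenvalues m G"
    using extremal_eigenvector[OF ex] extremal_nonneg_value[OF ex]
    by (intro image_eqI[of _ _ "of_real r"]) (auto simp: eigenvalues_def)
  moreover have "s \<le> r" if "s \<in> cmod ` hg_eigenvalues m G" for s
    using that eigenvector_modulus(1)[OF b] by (auto simp: eigenvalues_def)
  ultimately show ?thesis
    unfolding spectral_radius_def by (intro Greatest_equality) auto
qed

lemma extremal_spectral_radius_exists:
  obtains x where "extremal (hg_spectral_radius m G) x"
  using exists_extremal extremal_spectral_radius by metis

lemma form_bound_spectral_radius: "form_bound (hg_spectral_radius m G)"
  using extremal_spectral_radius_exists by (auto simp: extremal_def)

text \<open>The all-ones vector has positive form.\<close>

lemma spectral_radius_pos:
  assumes "edges G \<noteq> {}" shows "0 < hg_spectral_radius m G"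
proof -
  have "real m * edge_form G (\<lambda>_. 1) \<le> hg_spectral_radius m G * (\<Sum>i\<in>verts G. 1 ^ m)"
    using form_bound_spectral_radius[unfolded form_bound_def, rule_format, of "\<lambda>_. 1"] by simp
  moreover have "0 < real m * edge_form G (\<lambda>_. 1)"
    using assms m2 by (simp add: edge_form_def card_gt_0_iff)
  ultimately have "0 < hg_spectral_radius m G * real (card (verts G))" by simp
  then show ?thesis by (simp add: zero_less_mult_iff)
qed


section \<open>Uniqueness of the positive eigenvector\<close>

text \<open>Suppose that the zero set \<open>Z\<close> of \<open>x\<close> is nonempty.  Some edge meets both \<open>Z\<close> and its
  complement; it contributes \<open>0\<close> to the form, but at least \<open>c * t ^ (m - 1)\<close> with \<open>c > 0\<close> after all
  zeros have been replaced by \<open>t \<le> 1\<close>, because at most \<open>m - 1\<close> of its vertices are in \<open>Z\<close>.  The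
  power sum grows only by \<open>card Z * t ^ m\<close>, which contradicts maximality for small \<open>t\<close>.\<close>

lemma extremal_pos:
  assumes ind: "indecomposable G" and ex: "extremal r x" and i: "i \<in> verts G"
  shows "0 < x i"
proof (rule ccontr)
  assume ni: "\<not> 0 < x i"
  let ?V = "verts G"
  define Z where "Z = {k \<in> ?V. x k = 0}"
  have ZV: "Z \<subseteq> ?V" and finZ: "finite Z" by (auto simp: Z_def)
  have x0: "\<And>i. i \<in> ?V \<Longrightarrow> 0 \<le> x i" using ex by (auto simp: extremal_def)
  have r0: "0 \<le> r" using ex by (rule extremal_nonneg_value)
  have "i \<in> Z" using ni x0[OF i] i by (auto simp: Z_def)
  moreover have "?V - Z \<noteq> {}" using ex by (auto simp: extremal_def Z_def)
  ultimately obtain e where e: "e \<in> edges G" "e \<inter> (?V - Z) \<noteq> {}" "\<not> e \<subseteq> ?V - Z"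
    using ind ZV unfolding indecomposable_def by (metis Diff_iff Diff_subset subsetD)
  have eZ: "e \<inter> Z \<noteq> {}" using e edge_subset[OF e(1)] by blast
  define c where "c = (\<Prod>j\<in>e - Z. x j)"
  have c: "0 < c"
    unfolding c_def
  proof (rule prod_pos)
    fix j assume "j \<in> e - Z"
    then show "0 < x j" using edge_subset[OF e(1)] x0[of j] by (force simp: Z_def)
  qed
  define q where "q = r * real (card Z)"
  have q0: "0 \<le> q" using r0 by (simp add: q_def)
  have bound: "real m * c \<le> q * t" if t: "0 < t" "t \<le> 1" for t
  proof -
    define y where "y k = (if k \<in> Z then t else x k)" for k
    have y0: "\<And>k. k \<in> ?V \<Longrightarrow> 0 \<le> y k" using t x0 by (auto simp: y_def)
    have xy: "\<And>k. k \<in> ?V \<Longrightarrow> x k \<le> y k" using t by (auto simp: y_def Z_def)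
    have "(\<Sum>e'\<in>edges G - {e}. \<Prod>j\<in>e'. x j) \<le> (\<Sum>e'\<in>edges G - {e}. \<Prod>j\<in>e'. y j)"
      by (intro sum_mono prod_mono) (use x0 xy edge_subset in blast)
    moreover have "(\<Prod>j\<in>e. x j) = 0"
      using eZ finite_edge[OF e(1)] by (auto simp: Z_def intro!: prod_zero)
    moreover have "t ^ (m - 1) * c \<le> (\<Prod>j\<in>e. y j)"
    proof -
      have "(\<Prod>j\<in>e. y j) = (\<Prod>j\<in>e \<inter> Z. y j) * (\<Prod>j\<in>e - Z. y j)"
        by (rule prod.Int_Diff) (rule finite_edge[OF e(1)])
      also have "(\<Prod>j\<in>e - Z. y j) = c"
        unfolding c_def by (rule prod.cong) (auto simp: y_def)
      also have "(\<Prod>j\<in>e \<inter> Z. y j) = t ^ card (e \<inter> Z)"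
        by (simp add: y_def)
      finally have eq: "(\<Prod>j\<in>e. y j) = t ^ card (e \<inter> Z) * c" .
      have "card (e \<inter> Z) < card e"
        by (rule psubset_card_mono) (use finite_edge[OF e(1)] e(2) in auto)
      then have "card (e \<inter> Z) \<le> m - 1" using card_edge[OF e(1)] by simp
      then have "t ^ (m - 1) \<le> t ^ card (e \<inter> Z)" using t by (intro power_decreasing) auto
      then show ?thesis unfolding eq using c by simp
    qed
    ultimately have "edge_form G x + t ^ (m - 1) * c \<le> edge_form G y"
      using e(1) by (simp add: edge_form_def sum.remove[of _ e])
    then have "real m * (edge_form G x + t ^ (m - 1) * c) \<le> real m * edge_form G y"
      by (rule mult_left_mono) simp
    also have "\<dots> \<le> r * (\<Sum>k\<in>?V. y k ^ m)"
      using ex y0 unfolding extremal_def form_bound_def by blast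
    also have "(\<Sum>k\<in>?V. y k ^ m) = (\<Sum>k\<in>?V. x k ^ m + (if k \<in> Z then t ^ m else 0))"
      using m2 by (intro sum.cong) (auto simp: y_def Z_def power_0_left)
    also have "\<dots> = (\<Sum>k\<in>?V. x k ^ m) + real (card Z) * t ^ m"
      using ZV by (simp add: sum.distrib sum.If_cases Int_absorb1)
    finally have "real m * c * t ^ (m - 1) \<le> q * t ^ m"
      using ex by (simp add: extremal_def q_def algebra_simps)
    also have "\<dots> = q * t * t ^ (m - 1)" by (simp add: power_m[symmetric])
    finally show ?thesis using t by simp
  qed
  define p where "p = real m * c"
  have p: "0 < p" using c m2 by (simp add: p_def)
  \<comment> \<open>Small enough that \<open>q * t < p\<close>; the summand \<open>1\<close> covers \<open>q = 0\<close>.\<close>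
  define t where "t = min 1 (p / (2 * (q + 1)))"
  have "0 < t" "t \<le> 1" using p q0 by (auto simp: t_def)
  then have "p \<le> q * t" unfolding p_def by (rule bound)
  also have "\<dots> \<le> q * (p / (2 * (q + 1)))" using q0 by (intro mult_left_mono) (auto simp: t_def)
  also have "\<dots> < p" using p q0 by (simp add: field_simps) (intro add_nonneg_pos, auto)
  finally show False by simp
qed

text \<open>Let \<open>c\<close> be the largest factor with \<open>c * x \<le> y\<close>.  At a vertex where equality holds, the two
  eigenvalue equations agree, although every edge product for \<open>y\<close> dominates the one for \<open>c * x\<close>.
  So the products agree edge by edge, and by positivity equality spreads to all neighbours.\<close>

lemma extremal_unique:
  assumes ind: "indecomposable G" and ex: "extremal r x" and ey: "extremal r y"
  obtains c where "0 < c" "\<And>i. i \<in> verts G \<Longrightarrow> y i = c * x i"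
proof -
  let ?V = "verts G"
  have xp: "\<And>i. i \<in> ?V \<Longrightarrow> 0 < x i" and yp: "\<And>i. i \<in> ?V \<Longrightarrow> 0 < y i"
    using extremal_pos[OF ind] ex ey by auto
  define c where "c = Min ((\<lambda>i. y i / x i) ` ?V)"
  have cin: "c \<in> (\<lambda>i. y i / x i) ` ?V" unfolding c_def by (rule Min_in) (use verts_nonempty in auto)
  then have c0: "0 < c" using xp yp by auto
  have cle: "c * x i \<le> y i" if "i \<in> ?V" for i
  proof -
    have "c \<le> y i / x i" unfolding c_def using that by (intro Min_le) auto
    then show ?thesis using xp[OF that] by (simp add: field_simps)
  qed
  define S where "S = {i \<in> ?V. y i = c * x i}"
  have "S = ?V"
  proof -
    have "e \<subseteq> S" if e: "e \<in> edges G" and ne: "e \<inter> S \<noteq> {}" for e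
    proof
      fix j assume j: "j \<in> e"
      obtain i where i: "i \<in> e" "i \<in> S" using ne by auto
      have iV: "i \<in> ?V" using i by (simp add: S_def)
      show "j \<in> S"
      proof (cases "j = i")
        case False
        let ?E = "{e \<in> edges G. i \<in> e}"
        let ?d = "\<lambda>e. (\<Prod>k\<in>e - {i}. y k) - (\<Prod>k\<in>e - {i}. c * x k)"
        have mono: "(\<Prod>k\<in>e' - B. c * x k) \<le> (\<Prod>k\<in>e' - B. y k)" if "e' \<in> edges G" for e' B
          by (rule prod_mono) (use edge_subset[OF that] cle c0 xp in \<open>force simp: less_imp_le\<close>)
        have "link_sum G y i = link_sum G (\<lambda>k. c * x k) i"
          using i by (simp add: link_sum_scale extremal_link_sum[OF ex iV] extremal_link_sum[OF ey iV]
              S_def power_mult_distrib)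
        then have "(\<Sum>e\<in>?E. ?d e) = 0"
          by (simp add: link_sum_def sum_subtractf)
        moreover have "0 \<le> ?d e" if "e \<in> ?E" for e using mono that by simp
        ultimately have "?d e = 0"
          using e i by (subst (asm) sum_nonneg_eq_0_iff) auto
        moreover have "(\<Prod>k\<in>e - {i}. z k) = z j * (\<Prod>k\<in>e - {i, j}. z k)" for z :: "'a \<Rightarrow> real"
        proof -
          have "e - {i} - {j} = e - {i, j}" by auto
          then show ?thesis
            using prod.remove[of "e - {i}" j z] finite_edge[OF e] j False by simp
        qed
        ultimately have eq: "y j * (\<Prod>k\<in>e - {i, j}. y k) = c * x j * (\<Prod>k\<in>e - {i, j}. c * x k)"
          by simp
        have jV: "j \<in> ?V" using j edge_subset[OF e] by auto
        have "c * x j * (\<Prod>k\<in>e - {i, j}. c * x k) \<le> c * x j * (\<Prod>k\<in>e - {i, j}. y k)"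
          using mono[OF e] c0 xp[OF jV] by (intro mult_left_mono) auto
        moreover have "0 < (\<Prod>k\<in>e - {i, j}. y k)"
          by (rule prod_pos) (use yp edge_subset[OF e] in auto)
        ultimately have "y j \<le> c * x j" using eq by (metis mult_le_cancel_right_pos)
        then show ?thesis using cle[OF jV] jV by (simp add: S_def)
      qed (use i in simp)
    qed
    moreover have "S \<noteq> {}" using cin xp by (force simp: S_def)
    ultimately show ?thesis using ind by (auto simp: indecomposable_def S_def)
  qed
  then show ?thesis using that c0 by (auto simp: S_def)
qed

end

section \<open>Points of projective space\<close>

definition proj_point :: "'a set \<Rightarrow> ('a \<Rightarrow> complex) \<Rightarrow> ('a \<Rightarrow> complex) set" where
  "proj_point I x = proj_rel I `` {x}"

lemma proj_space_eq: "proj_space I = proj_point I ` nonzero_cvecs I"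
  by (auto simp: proj_space_def quotient_def proj_point_def)

lemma mem_proj_point:
  "x \<in> nonzero_cvecs I \<Longrightarrow> z \<in> proj_point I x \<longleftrightarrow> (\<exists>c. c \<noteq> 0 \<and> z = (\<lambda>i. c * x i))"
  by (auto simp: proj_point_def proj_rel_def nonzero_cvecs_def cvecs_def fun_eq_iff)

lemma proj_point_eq_iff:
  assumes "x \<in> nonzero_cvecs I" "y \<in> nonzero_cvecs I"
  shows "proj_point I x = proj_point I y \<longleftrightarrow> (\<exists>c. c \<noteq> 0 \<and> y = (\<lambda>i. c * x i))"
  using eq_equiv_class_iff[OF equiv_proj_rel assms] assms
  by (auto simp: proj_point_def proj_rel_def)

context uniform_hg
begin

lemma eigenvariety_eq_image:
  "hg_proj_eigenvariety m G l = proj_point (verts G) ` hg_eigenvectors m G l"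
proof -
  have "(\<forall>z\<in>proj_point (verts G) x. eigen_eq m (verts G) (adjacency_tensor m G) l z) \<longleftrightarrow>
      eigen_eq m (verts G) (adjacency_tensor m G) l x" if x: "x \<in> nonzero_cvecs (verts G)" for x
  proof
    assume "\<forall>z\<in>proj_point (verts G) x. eigen_eq m (verts G) (adjacency_tensor m G) l z"
    moreover have "x \<in> proj_point (verts G) x"
      unfolding mem_proj_point[OF x] by (rule exI[of _ 1]) simp
    ultimately show "eigen_eq m (verts G) (adjacency_tensor m G) l x" by blast
  next
    assume "eigen_eq m (verts G) (adjacency_tensor m G) l x"
    then show "\<forall>z\<in>proj_point (verts G) x. eigen_eq m (verts G) (adjacency_tensor m G) l z"
      by (auto simp: mem_proj_point[OF x] eigen_eq_adjacency link_sum_scale power_mult_distrib)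
  qed
  then show ?thesis
    by (auto simp: proj_eigenvariety_def proj_space_eq eigenvectors_def)
qed

text \<open>Every point of the eigenvariety is represented by an element of \<open>F\<close>.\<close>

lemma eigenvariety_finite:
  assumes "finite F" "F \<subseteq> hg_eigenvectors m G l"
    and span: "\<And>x. x \<in> hg_eigenvectors m G l \<Longrightarrow> \<exists>y\<in>F. \<exists>c. x = (\<lambda>i. c * y i)"
  shows "finite (hg_proj_eigenvariety m G l)"
proof (rule finite_surj)
  show "finite F" by fact
  show "hg_proj_eigenvariety m G l \<subseteq> proj_point (verts G) ` F"
    unfolding eigenvariety_eq_image
  proof
    fix P assume "P \<in> proj_point (verts G) ` hg_eigenvectors m G l"
    then obtain x where x: "x \<in> hg_eigenvectors m G l" "P = proj_point (verts G) x" by blast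
    then obtain y c where y: "y \<in> F" "x = (\<lambda>i. c * y i)" using span by blast
    have nz: "x \<in> nonzero_cvecs (verts G)" "y \<in> nonzero_cvecs (verts G)"
      using x y assms(2) by (auto simp: eigenvectors_def)
    then have "c \<noteq> 0" using y by (auto simp: nonzero_cvecs_def)
    then have "P = proj_point (verts G) y"
      unfolding x(2) using proj_point_eq_iff[OF nz(2,1)] y(2) by blast
    then show "P \<in> proj_point (verts G) ` F" using y by blast
  qed
qed

end

section \<open>Phases of the peripheral eigenvectors\<close>

text \<open>Equality in the triangle inequality: a combination of points of the unit circle with positive weights of sum one
  lies on the circle only if all the points coincide.  After rotation by \<open>cnj c\<close> the real parts,
  which are at most \<open>1\<close>, have weighted mean \<open>1\<close>.\<close>

lemma aligned_sum:
  fixes w :: "'b \<Rightarrow> real" and z :: "'b \<Rightarrow> complex"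
  assumes fin: "finite A" and w: "\<And>a. a \<in> A \<Longrightarrow> 0 < w a"
    and z: "\<And>a. a \<in> A \<Longrightarrow> cmod (z a) = 1" and c: "cmod c = 1"
    and eq: "(\<Sum>a\<in>A. of_real (w a) * z a) = of_real (\<Sum>a\<in>A. w a) * c" and a: "a \<in> A"
  shows "z a = c"
proof -
  have cc: "c * cnj c = 1" using c by (simp add: complex_norm_square[symmetric])
  have "(\<Sum>a\<in>A. of_real (w a) * (z a * cnj c)) = (\<Sum>a\<in>A. of_real (w a) * z a) * cnj c"
    by (simp add: sum_distrib_right mult.assoc)
  also have "\<dots> = of_real (\<Sum>a\<in>A. w a)" by (simp add: eq mult.assoc cc)
  finally have "Re (\<Sum>a\<in>A. of_real (w a) * (z a * cnj c)) = (\<Sum>a\<in>A. w a)" by simp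
  moreover have "Re (of_real r * u) = r * Re u" for r u by simp
  ultimately have "(\<Sum>a\<in>A. w a * (1 - Re (z a * cnj c))) = 0"
    by (simp add: right_diff_distrib sum_subtractf del: times_complex.sel)
  moreover have n: "cmod (z a * cnj c) = 1" if "a \<in> A" for a using z[OF that] c by (simp add: norm_mult)
  moreover have "0 \<le> w a * (1 - Re (z a * cnj c))" if "a \<in> A" for a
    using w[OF that] complex_Re_le_cmod[of "z a * cnj c"] n[OF that] by (intro mult_nonneg_nonneg) auto
  ultimately have "w a * (1 - Re (z a * cnj c)) = 0"
    using fin a by (subst (asm) sum_nonneg_eq_0_iff) auto
  then have "Re (z a * cnj c) = 1" using w[OF a] by simp
  then have "z a * cnj c = 1"
    using n[OF a] by (auto simp: complex_eq_iff cmod_def simp del: times_complex.sel)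
  then have "z a * (c * cnj c) = c" by (metis mult.assoc mult.commute mult_1)
  then show ?thesis by (simp add: cc)
qed

lemma norm_mult_sgn: "of_real (cmod z) * sgn z = z"
  by (cases "z = 0") (auto simp: sgn_eq)

context uniform_hg
begin

text \<open>The eigenvalue equation for phases \<open>u\<close>, with \<open>w = l / \<rho>\<close>.  Multiplying both sides by \<open>u i\<close>
  makes the left side independent of the vertex \<open>i\<close> of the edge.\<close>

definition edge_aligned :: "complex \<Rightarrow> ('a \<Rightarrow> complex) \<Rightarrow> bool" where
  "edge_aligned w u \<longleftrightarrow> (\<forall>e\<in>edges G. \<forall>i\<in>e. (\<Prod>j\<in>e. u j) = w * u i ^ m)"

text \<open>Under alignment all terms of \<open>link_sum\<close> at \<open>i\<close> have the common phase \<open>w * u i ^ (m - 1)\<close>, which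
  can be pulled out of the sum.\<close>

lemma edge_aligned_eigenvector:
  assumes ex: "extremal r x" and u: "\<And>i. i \<in> verts G \<Longrightarrow> u i \<noteq> 0" and al: "edge_aligned w u"
  shows "(\<lambda>i. if i \<in> verts G then of_real (x i) * u i else 0) \<in> hg_eigenvectors m G (of_real r * w)"
    (is "?y \<in> _")
proof -
  have "link_sum G ?y i = of_real r * w * ?y i ^ (m - 1)" if i: "i \<in> verts G" for i
  proof -
    have "link_sum G ?y i = (\<Sum>e | e \<in> edges G \<and> i \<in> e. of_real (\<Prod>j\<in>e - {i}. x j) * (w * u i ^ (m - 1)))"
      unfolding link_sum_def
    proof (rule sum.cong[OF refl])
      fix e assume "e \<in> {e \<in> edges G. i \<in> e}"
      then have e: "e \<in> edges G" "i \<in> e" by auto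
      have "u i * (\<Prod>j\<in>e - {i}. u j) = u i * (w * u i ^ (m - 1))"
        using al e by (simp add: edge_aligned_def prod_edge_split[symmetric] mult.left_commute power_m)
      then have "(\<Prod>j\<in>e - {i}. u j) = w * u i ^ (m - 1)" using u[OF i] by simp
      moreover have "(\<Prod>j\<in>e - {i}. ?y j) = (\<Prod>j\<in>e - {i}. of_real (x j) * u j)"
        by (rule prod.cong) (use edge_subset[OF e(1)] in auto)
      ultimately show "(\<Prod>j\<in>e - {i}. ?y j) = of_real (\<Prod>j\<in>e - {i}. x j) * (w * u i ^ (m - 1))"
        by (simp add: prod.distrib)
    qed
    also have "\<dots> = of_real (link_sum G x i) * (w * u i ^ (m - 1))"
      by (simp add: link_sum_def sum_distrib_right)
    finally show ?thesis
      using i by (simp add: extremal_link_sum[OF ex i] power_mult_distrib mult_ac)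
  qed
  moreover obtain k where "k \<in> verts G" "x k \<noteq> 0" using ex by (auto simp: extremal_def)
  ultimately show ?thesis using u by (intro eigenvectorsI[of _ _ k]) auto
qed

lemma eigenvector_scale:
  assumes "y \<in> hg_eigenvectors m G l" "c \<noteq> 0"
  shows "(\<lambda>i. c * y i) \<in> hg_eigenvectors m G l"
proof -
  obtain k where "k \<in> verts G" "y k \<noteq> 0" using eigenvectorsD(2)[OF assms(1)] by blast
  then show ?thesis
    using eigenvectorsD(1,3)[OF assms(1)] assms(2)
    by (intro eigenvectorsI[of _ _ k]) (auto simp: link_sum_scale power_mult_distrib mult_ac)
qed

context
  assumes ind: "indecomposable G" and has_edge: "edges G \<noteq> {}"
begin

abbreviation \<rho> :: real where "\<rho> \<equiv> hg_spectral_radius m G"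

lemma peripheral_extremal:
  assumes "y \<in> hg_eigenvectors m G l" "cmod l = \<rho>"
  shows "extremal \<rho> (\<lambda>i. cmod (y i))"
  using eigenvector_modulus(2)[OF form_bound_spectral_radius assms] .

lemma peripheral_nonzero:
  assumes "y \<in> hg_eigenvectors m G l" "cmod l = \<rho>" "i \<in> verts G"
  shows "y i \<noteq> 0"
  using extremal_pos[OF ind peripheral_extremal[OF assms(1,2)] assms(3)] by simp

text \<open>Divided by its phase, the equation at \<open>i\<close> writes a point of the circle as an average of edge
  phases, with the edge products of the moduli as weights; these sum to \<open>\<rho> * cmod (y i) ^ (m - 1)\<close>
  because the moduli are extremal.\<close>

lemma peripheral_edge_aligned:
  assumes y: "y \<in> hg_eigenvectors m G l" and l: "cmod l = \<rho>"
  shows "edge_aligned (sgn l) (\<lambda>i. sgn (y i))"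
  unfolding edge_aligned_def
proof (intro ballI)
  fix e i assume e: "e \<in> edges G" and i: "i \<in> e"
  have iV: "i \<in> verts G" using e i edge_subset by auto
  have n1: "cmod (sgn (y j)) = 1" if "j \<in> verts G" for j
    using peripheral_nonzero[OF y l that] by (simp add: norm_sgn)
  have l0: "l \<noteq> 0" using l spectral_radius_pos[OF has_edge] by auto
  have "(\<Prod>j\<in>e - {i}. sgn (y j)) = sgn l * sgn (y i) ^ (m - 1)"
  proof (rule aligned_sum[where A = "{e \<in> edges G. i \<in> e}" and w = "\<lambda>e. \<Prod>j\<in>e - {i}. cmod (y j)"
        and z = "\<lambda>e. \<Prod>j\<in>e - {i}. sgn (y j)"])
    show "0 < (\<Prod>j\<in>e - {i}. cmod (y j))" if "e \<in> {e \<in> edges G. i \<in> e}" for e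
      by (rule prod_pos) (use that edge_subset peripheral_nonzero[OF y l] in auto)
    show "cmod (\<Prod>j\<in>e - {i}. sgn (y j)) = 1" if "e \<in> {e \<in> edges G. i \<in> e}" for e
      unfolding prod_norm[symmetric]
      by (rule prod.neutral) (use that edge_subset n1 in auto)
    show "cmod (sgn l * sgn (y i) ^ (m - 1)) = 1"
      using l0 n1[OF iV] by (simp add: norm_mult norm_power norm_sgn)
    have "(\<Sum>e | e \<in> edges G \<and> i \<in> e. of_real (\<Prod>j\<in>e - {i}. cmod (y j)) * (\<Prod>j\<in>e - {i}. sgn (y j)))
        = link_sum G (\<lambda>j. of_real (cmod (y j)) * sgn (y j)) i"
      by (simp add: link_sum_def prod.distrib)
    also have "\<dots> = link_sum G y i" by (simp only: norm_mult_sgn)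
    also have "\<dots> = (of_real (cmod l) * sgn l) * (of_real (cmod (y i)) * sgn (y i)) ^ (m - 1)"
      by (simp only: eigenvectorsD(1)[OF y iV] norm_mult_sgn)
    also have "\<dots> = of_real (\<rho> * cmod (y i) ^ (m - 1)) * (sgn l * sgn (y i) ^ (m - 1))"
      by (simp add: l power_mult_distrib mult_ac)
    also have "\<rho> * cmod (y i) ^ (m - 1) = link_sum G (\<lambda>j. cmod (y j)) i"
      by (rule extremal_link_sum[OF peripheral_extremal[OF y l] iV, symmetric])
    finally show "(\<Sum>e | e \<in> edges G \<and> i \<in> e. of_real (\<Prod>j\<in>e - {i}. cmod (y j)) * (\<Prod>j\<in>e - {i}. sgn (y j)))
        = of_real (\<Sum>e | e \<in> edges G \<and> i \<in> e. \<Prod>j\<in>e - {i}. cmod (y j)) * (sgn l * sgn (y i) ^ (m - 1))"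
      by (simp add: link_sum_def)
  qed (use e i in auto)
  then show "(\<Prod>j\<in>e. sgn (y j)) = sgn l * sgn (y i) ^ m"
    by (simp add: prod_edge_split[OF e i] mult.left_commute power_m)
qed

text \<open>With \<open>x\<close> a fixed extremal vector, every eigenvector is a multiple of one whose coordinates are
  \<open>x i\<close> times an \<open>m\<close>-th root of unity: the moduli are proportional to \<open>x\<close>, and the \<open>m\<close>-th powers of the
  phases agree at all vertices, since alignment at two vertices of an edge has the same left side.\<close>

lemma peripheral_eigenvectors_finite:
  assumes l: "cmod l = \<rho>"
  shows "\<exists>F \<subseteq> hg_eigenvectors m G l. finite F \<and>
           (\<forall>x \<in> hg_eigenvectors m G l. \<exists>y\<in>F. \<exists>c. x = (\<lambda>i. c * y i))"
proof -
  let ?V = "verts G"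
  obtain x where ex: "extremal \<rho> x" by (rule extremal_spectral_radius_exists)
  obtain v where v: "v \<in> ?V" using verts_nonempty by auto
  define F where "F = {z :: 'a \<Rightarrow> complex. (\<forall>i. (i \<in> ?V \<longrightarrow> z i \<in> (\<lambda>u. of_real (x i) * u) ` {u. u ^ m = 1}) \<and>
                              (i \<notin> ?V \<longrightarrow> z i = 0))}"
  have finF: "finite F"
  proof -
    have "finite {u::complex. u ^ m = 1}" using m2 by (intro finite_roots_unity) auto
    then have "finite (PiE ?V (\<lambda>i. (\<lambda>u. of_real (x i) * u) ` {u::complex. u ^ m = 1}))"
      by (intro finite_PiE) auto
    moreover have "F \<subseteq> (\<lambda>z i. if i \<in> ?V then z i else 0) `
        PiE ?V (\<lambda>i. (\<lambda>u. of_real (x i) * u) ` {u::complex. u ^ m = 1})"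
    proof
      fix z assume z: "z \<in> F"
      then have "z = (\<lambda>i. if i \<in> ?V then restrict z ?V i else 0)" by (auto simp: F_def)
      moreover have "restrict z ?V \<in> PiE ?V (\<lambda>i. (\<lambda>u. of_real (x i) * u) ` {u::complex. u ^ m = 1})"
        using z by (auto simp: F_def)
      ultimately show "z \<in> (\<lambda>z i. if i \<in> ?V then z i else 0) `
          PiE ?V (\<lambda>i. (\<lambda>u. of_real (x i) * u) ` {u::complex. u ^ m = 1})" by blast
    qed
    ultimately show ?thesis by (rule finite_surj)
  qed
  have "\<exists>z \<in> F \<inter> hg_eigenvectors m G l. \<exists>c. y = (\<lambda>i. c * z i)" if y: "y \<in> hg_eigenvectors m G l" for y
  proof -
    obtain c where c: "0 < c" "\<And>i. i \<in> ?V \<Longrightarrow> cmod (y i) = c * x i"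
      using extremal_unique[OF ind ex peripheral_extremal[OF y l]] by blast
    let ?u = "\<lambda>i. sgn (y i)"
    have u0: "?u i \<noteq> 0" if "i \<in> ?V" for i
      using peripheral_nonzero[OF y l that] by (simp add: sgn_zero_iff)
    have al: "edge_aligned (sgn l) ?u" by (rule peripheral_edge_aligned[OF y l])
    have l0: "sgn l \<noteq> 0" using l spectral_radius_pos[OF has_edge] by (auto simp: sgn_zero_iff)
    define S where "S = {i \<in> ?V. ?u i ^ m = ?u v ^ m}"
    have "e \<subseteq> S" if e: "e \<in> edges G" and ne: "e \<inter> S \<noteq> {}" for e
    proof
      fix j assume j: "j \<in> e"
      obtain i where i: "i \<in> e" "i \<in> S" using ne by auto
      have "sgn l * ?u i ^ m = sgn l * ?u j ^ m"
        using al e i j unfolding edge_aligned_def by metis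
      then have "?u i ^ m = ?u j ^ m" using l0 by simp
      then show "j \<in> S" using i j edge_subset[OF e] by (auto simp: S_def)
    qed
    moreover have "S \<noteq> {}" using v by (auto simp: S_def)
    ultimately have S: "S = ?V" using ind by (auto simp: indecomposable_def S_def)
    define d where "d = of_real c * ?u v"
    have d0: "d \<noteq> 0" using c u0[OF v] by (simp add: d_def)
    define z where "z i = inverse d * y i" for i
    have yz: "y = (\<lambda>i. d * z i)" using d0 by (simp add: z_def mult.assoc[symmetric])
    have "z i \<in> (\<lambda>u. of_real (x i) * u) ` {u. u ^ m = 1}" if i: "i \<in> ?V" for i
    proof
      have "y i = of_real (cmod (y i)) * ?u i" by (simp only: norm_mult_sgn)
      then show "z i = of_real (x i) * (?u i / ?u v)"
        using c u0[OF v] by (simp add: z_def d_def c(2)[OF i] field_simps)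
      show "?u i / ?u v \<in> {u. u ^ m = 1}"
        using i u0[OF v] S by (auto simp: S_def power_divide)
    qed
    moreover have "z i = 0" if "i \<notin> ?V" for i using that eigenvectorsD(3)[OF y] by (simp add: z_def)
    ultimately have "z \<in> F" by (simp add: F_def)
    moreover have "z \<in> hg_eigenvectors m G l"
      unfolding z_def using d0 by (intro eigenvector_scale y) auto
    ultimately show ?thesis using yz by blast
  qed
  then show ?thesis using finF by (intro exI[of _ "F \<inter> hg_eigenvectors m G l"]) auto
qed

text \<open>Alignment is multiplicative: the phases of \<open>y\<close> times those of \<open>b\<close> over those of \<open>a\<close> are aligned
  with respect to \<open>sgn l * (sgn l' / sgn l)\<close>, and the moduli of the coordinates do not change.\<close>

lemma twisted_eigenvector:
  assumes l: "cmod l = \<rho>" and l': "cmod l' = \<rho>"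
    and a: "a \<in> hg_eigenvectors m G l" and b: "b \<in> hg_eigenvectors m G l'"
    and y: "y \<in> hg_eigenvectors m G l"
  shows "(\<lambda>i. y i * (sgn (b i) / sgn (a i))) \<in> hg_eigenvectors m G l'"
proof -
  let ?u = "\<lambda>i. sgn (y i) * (sgn (b i) / sgn (a i))"
  have nz: "sgn (y i) \<noteq> 0" "sgn (a i) \<noteq> 0" "sgn (b i) \<noteq> 0" if "i \<in> verts G" for i
    using that peripheral_nonzero[OF y l] peripheral_nonzero[OF a l] peripheral_nonzero[OF b l']
    by (auto simp: sgn_zero_iff)
  have l0: "sgn l \<noteq> 0" using l spectral_radius_pos[OF has_edge] by (auto simp: sgn_zero_iff)
  have "edge_aligned (sgn l * (sgn l' / sgn l)) ?u"
    using peripheral_edge_aligned[OF y l] peripheral_edge_aligned[OF a l] peripheral_edge_aligned[OF b l']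
    unfolding edge_aligned_def by (simp add: prod.distrib prod_dividef power_mult_distrib power_divide)
  then have "edge_aligned (sgn l') ?u" using l0 by simp
  then have "(\<lambda>i. if i \<in> verts G then of_real (cmod (y i)) * ?u i else 0)
      \<in> hg_eigenvectors m G (of_real \<rho> * sgn l')"
    by (intro edge_aligned_eigenvector peripheral_extremal[OF y l]) (use nz in auto)
  moreover have "(\<lambda>i. if i \<in> verts G then of_real (cmod (y i)) * ?u i else 0) =
      (\<lambda>i. y i * (sgn (b i) / sgn (a i)))"
    by (auto simp: fun_eq_iff eigenvectorsD(3)[OF y] norm_mult_sgn mult.assoc[symmetric])
  moreover have "of_real \<rho> * sgn l' = l'" by (simp only: l'[symmetric] norm_mult_sgn)
  ultimately show ?thesis by simp
qed

lemma peripheral_eigenvariety_finite: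
  "cmod l = \<rho> \<Longrightarrow> finite (hg_proj_eigenvariety m G l)"
  using peripheral_eigenvectors_finite[of l] eigenvariety_finite[of _ l] by blast

text \<open>Twisting is linear and invertible, so it maps lines to lines and acts injectively on the points
  of projective space, which are sets of vectors.\<close>

lemma peripheral_eigenvariety_card_le:
  assumes l: "cmod l = \<rho>" "l \<in> hg_eigenvalues m G" and l': "cmod l' = \<rho>" "l' \<in> hg_eigenvalues m G"
  shows "card (hg_proj_eigenvariety m G l) \<le> card (hg_proj_eigenvariety m G l')"
proof -
  obtain a b where a: "a \<in> hg_eigenvectors m G l" and b: "b \<in> hg_eigenvectors m G l'"
    using l l' by (auto simp: eigenvalues_def)
  define T where "T y i = y i * (sgn (b i) / sgn (a i))" for y :: "'a \<Rightarrow> complex" and i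
  have T: "T y \<in> hg_eigenvectors m G l'" if "y \<in> hg_eigenvectors m G l" for y
    unfolding T_def using twisted_eigenvector[OF l(1) l'(1) a b that] .
  have "inj_on T (cvecs (verts G))"
  proof (rule inj_onI, rule ext)
    fix y z i assume yz: "y \<in> cvecs (verts G)" "z \<in> cvecs (verts G)" "T y = T z"
    show "y i = z i"
    proof (cases "i \<in> verts G")
      case True
      then have "sgn (b i) / sgn (a i) \<noteq> 0"
        using peripheral_nonzero[OF a l(1)] peripheral_nonzero[OF b l'(1)] by (simp add: sgn_zero_iff)
      then show ?thesis using fun_cong[OF yz(3), of i] unfolding T_def by simp
    qed (use yz in \<open>simp add: cvecs_def\<close>)
  qed
  then have inj: "inj_on ((`) T) (Pow (cvecs (verts G)))"
    by (rule inj_on_image_Pow)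
  have sub: "hg_proj_eigenvariety m G l \<subseteq> Pow (cvecs (verts G))"
    by (auto simp: proj_eigenvariety_def proj_space_def quotient_def proj_rel_def nonzero_cvecs_def)
  show ?thesis
  proof (rule card_inj_on_le)
    show "inj_on ((`) T) (hg_proj_eigenvariety m G l)" by (rule inj_on_subset[OF inj sub])
    show "finite (hg_proj_eigenvariety m G l')" by (rule peripheral_eigenvariety_finite) fact
    show "(`) T ` hg_proj_eigenvariety m G l \<subseteq> hg_proj_eigenvariety m G l'"
    proof
      fix Q assume "Q \<in> (`) T ` hg_proj_eigenvariety m G l"
      then obtain y where y: "y \<in> hg_eigenvectors m G l" "Q = T ` proj_point (verts G) y"
        unfolding eigenvariety_eq_image by blast
      have nz: "y \<in> nonzero_cvecs (verts G)" "T y \<in> nonzero_cvecs (verts G)"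
        using y(1) T[OF y(1)] by (auto simp: eigenvectors_def)
      have "T (\<lambda>i. c * y i) = (\<lambda>i. c * T y i)" for c
        by (auto simp: T_def mult.assoc)
      moreover have "proj_point (verts G) z = (\<lambda>c i. c * z i) ` {c. c \<noteq> 0}"
        if "z \<in> nonzero_cvecs (verts G)" for z
        using mem_proj_point[OF that] by auto
      ultimately have "Q = proj_point (verts G) (T y)"
        unfolding y(2) using nz by (simp add: image_image)
      then show "Q \<in> hg_proj_eigenvariety m G l'"
        unfolding eigenvariety_eq_image using T[OF y(1)] by blast
    qed
  qed
qed

end

end

section \<open>Connected components\<close>

definition edge_step :: "'a hypergraph \<Rightarrow> ('a \<times> 'a) set" where
  "edge_step G = {(a, b). \<exists>e\<in>edges G. a \<in> e \<and> b \<in> e}"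

lemma hyperwalk_edge_steps:
  "hyperwalk G vs es \<Longrightarrow> (hd vs, last vs) \<in> (edge_step G)\<^sup>*"
proof (induction es arbitrary: vs)
  case Nil
  then have "length vs = 1" by (simp add: hyperwalk_def)
  then obtain v where "vs = [v]" by (auto simp: length_Suc_conv)
  then show ?case by simp
next
  case (Cons e es)
  then obtain a b vs' where vs: "vs = a # b # vs'"
    by (auto simp: hyperwalk_def length_Suc_conv)
  have "\<forall>i<Suc (length es). {vs ! i, vs ! Suc i} \<subseteq> (e # es) ! i"
    using Cons.prems by (simp add: hyperwalk_def)
  then have 0: "{a, b} \<subseteq> e" and "\<forall>i<length es. {(b # vs') ! i, (b # vs') ! Suc i} \<subseteq> es ! i"
    unfolding vs by (fastforce dest: spec[of _ 0], fastforce dest: spec[of _ "Suc _"])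
  then have "hyperwalk G (b # vs') es" using Cons.prems by (simp add: hyperwalk_def vs)
  from Cons.IH[OF this] have "(b, last vs) \<in> (edge_step G)\<^sup>*" by (simp add: vs)
  moreover have "(a, b) \<in> edge_step G"
    using 0 Cons.prems by (auto simp: edge_step_def hyperwalk_def)
  ultimately show ?case by (simp add: vs converse_rtrancl_into_rtrancl)
qed

lemma hyperwalk_Cons:
  assumes "hyperwalk G vs es" "e \<in> edges G" "a \<in> verts G" "a \<in> e" "hd vs \<in> e"
  shows "hyperwalk G (a # vs) (e # es)"
proof -
  have "vs \<noteq> []" using assms(1) by (auto simp: hyperwalk_def)
  then have "vs ! 0 = hd vs" by (simp add: hd_conv_nth)
  then show ?thesis
    using assms by (auto simp: hyperwalk_def nth_Cons split: nat.splits)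
qed

context uniform_hg
begin

text \<open>Reachability along edges replaces walks by induction on a reflexive transitive closure.  The
  intersection matters because a closure is reflexive everywhere, whereas walks visit vertices only.\<close>

lemma vert_connected_rel_eq:
  "vert_connected_rel G = (edge_step G)\<^sup>* \<inter> verts G \<times> verts G"
proof (intro equalityI subrelI)
  fix u w assume "(u, w) \<in> vert_connected_rel G"
  then obtain vs es where w: "hyperwalk G vs es" "hd vs = u" "last vs = w"
    by (auto simp: vert_connected_rel_def)
  then have "vs \<noteq> []" by (auto simp: hyperwalk_def)
  then have "u \<in> set vs" "w \<in> set vs" using w by auto
  then show "(u, w) \<in> (edge_step G)\<^sup>* \<inter> verts G \<times> verts G"
    using hyperwalk_edge_steps[OF w(1)] w by (auto simp: hyperwalk_def)
next
  fix u w assume "(u, w) \<in> (edge_step G)\<^sup>* \<inter> verts G \<times> verts G"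
  then have uw: "(u, w) \<in> (edge_step G)\<^sup>*" and "w \<in> verts G" by auto
  from uw have "\<exists>vs es. hyperwalk G vs es \<and> hd vs = u \<and> last vs = w"
  proof (induction rule: converse_rtrancl_induct)
    case base
    have "hyperwalk G [w] []" using \<open>w \<in> verts G\<close> by (simp add: hyperwalk_def)
    then show ?case by (intro exI[of _ "[w]"] exI[of _ "[]"]) simp
  next
    case (step a b)
    then obtain vs es where w: "hyperwalk G vs es" "hd vs = b" "last vs = w" by blast
    obtain e where e: "e \<in> edges G" "a \<in> e" "b \<in> e" using step by (auto simp: edge_step_def)
    have "hyperwalk G (a # vs) (e # es)"
      using hyperwalk_Cons[OF w(1) e(1)] e w edge_subset by blast
    moreover have "vs \<noteq> []" using w by (auto simp: hyperwalk_def)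
    ultimately show ?case using w by (intro exI[of _ "a # vs"] exI[of _ "e # es"]) simp
  qed
  then show "(u, w) \<in> vert_connected_rel G" by (simp add: vert_connected_rel_def)
qed

lemma equiv_vert_connected: "equiv (verts G) (vert_connected_rel G)"
proof (rule equivI)
  have "sym (edge_step G)" by (auto simp: sym_def edge_step_def)
  then have "sym ((edge_step G)\<^sup>*)" by (rule sym_rtrancl)
  then show "sym (vert_connected_rel G)" unfolding vert_connected_rel_eq by (auto simp: sym_def)
  show "trans (vert_connected_rel G)"
    unfolding vert_connected_rel_eq by (auto simp: trans_def)
qed (auto simp: vert_connected_rel_eq refl_on_def)

abbreviation component_sets :: "'a set set" where
  "component_sets \<equiv> verts G // vert_connected_rel G"

lemma component_subset: "\<alpha> \<in> component_sets \<Longrightarrow> \<alpha> \<subseteq> verts G"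
  using equiv_vert_connected in_quotient_imp_subset by blast

lemma component_nonempty: "\<alpha> \<in> component_sets \<Longrightarrow> \<alpha> \<noteq> {}"
  using equiv_vert_connected in_quotient_imp_non_empty by blast

lemma components_disjoint:
  "\<alpha> \<in> component_sets \<Longrightarrow> \<beta> \<in> component_sets \<Longrightarrow> \<alpha> \<noteq> \<beta> \<Longrightarrow> \<alpha> \<inter> \<beta> = {}"
  using quotient_disj[OF equiv_vert_connected] by blast

lemma component_of:
  assumes "i \<in> verts G"
  obtains \<alpha> where "\<alpha> \<in> component_sets" "i \<in> \<alpha>"
  using assms Union_quotient[OF equiv_vert_connected] by blast

lemma edge_in_component:
  assumes \<alpha>: "\<alpha> \<in> component_sets" and e: "e \<in> edges G" and "e \<inter> \<alpha> \<noteq> {}"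
  shows "e \<subseteq> \<alpha>"
proof
  fix b assume b: "b \<in> e"
  obtain a where a: "a \<in> e" "a \<in> \<alpha>" using assms by blast
  have "(a, b) \<in> vert_connected_rel G"
    using a b e edge_subset[OF e] by (auto simp: vert_connected_rel_eq edge_step_def)
  then show "b \<in> \<alpha>"
    using \<alpha> a in_quotient_imp_closed[OF equiv_vert_connected] by blast
qed

lemma uniform_hg_component: "\<alpha> \<in> component_sets \<Longrightarrow> uniform_hg m (induced_component G \<alpha>)"
  using m2 component_subset component_nonempty card_edge finite_subset[OF _ finite_verts]
  by unfold_locales (auto simp: uniform_hypergraph_def induced_component_def)

lemma indecomposable_component:
  assumes \<alpha>: "\<alpha> \<in> component_sets"
  shows "indecomposable (induced_component G \<alpha>)"
  unfolding indecomposable_def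
proof (intro allI impI)
  fix S assume S: "S \<subseteq> verts (induced_component G \<alpha>)" "S \<noteq> {}"
    and closed: "\<forall>e\<in>edges (induced_component G \<alpha>). e \<inter> S \<noteq> {} \<longrightarrow> e \<subseteq> S"
  have S\<alpha>: "S \<subseteq> \<alpha>" using S by (simp add: induced_component_def)
  obtain u where u: "u \<in> S" using S by blast
  have "w \<in> S" if "w \<in> \<alpha>" for w
  proof -
    have "(u, w) \<in> vert_connected_rel G"
      using \<alpha> u S\<alpha> that quotient_eq_iff[OF equiv_vert_connected \<alpha> \<alpha>] by blast
    then have "(u, w) \<in> (edge_step G)\<^sup>*" by (simp add: vert_connected_rel_eq)
    then show ?thesis
    proof (induction rule: rtrancl_induct)
      case base
      show ?case by (rule u)
    next
      case (step a b)
      then obtain e where e: "e \<in> edges G" "a \<in> e" "b \<in> e" by (auto simp: edge_step_def)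
      then have "e \<subseteq> \<alpha>" using edge_in_component[OF \<alpha> e(1)] step S\<alpha> by blast
      then show ?case using closed e step by (auto simp: induced_component_def)
    qed
  qed
  then show "S = verts (induced_component G \<alpha>)" using S\<alpha> by (auto simp: induced_component_def)
qed

lemma inj_induced_component: "inj_on (induced_component G) A"
  by (rule inj_onI) (simp add: induced_component_def)

lemma finite_component_sets: "finite component_sets"
  by (rule finite_subset[of _ "Pow (verts G)"]) (use component_subset in auto)

text \<open>The only component is then \<open>G\<close> itself.\<close>

lemma connected_indecomposable:
  assumes "connected_hypergraph G" shows "indecomposable G"
proof -
  have "card component_sets = 1"
    using assms by (simp add: connected_hypergraph_def hypergraph_components_def
        card_image[OF inj_induced_component])
  then obtain \<alpha> where \<alpha>: "component_sets = {\<alpha>}" by (auto simp: card_1_singleton_iff)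
  then have "\<alpha> = verts G" using Union_quotient[OF equiv_vert_connected] by simp
  then have "indecomposable (induced_component G (verts G))"
    using indecomposable_component[of \<alpha>] \<alpha> by simp
  moreover have "{e \<in> edges G. e \<subseteq> verts G} = edges G" using edge_subset by blast
  ultimately show ?thesis by (simp add: indecomposable_def induced_component_def)
qed

lemma verts_component [simp]: "verts (induced_component G \<alpha>) = \<alpha>"
  by (simp add: induced_component_def)

lemma link_sum_component:
  assumes "\<alpha> \<in> component_sets" "i \<in> \<alpha>"
  shows "link_sum (induced_component G \<alpha>) x i = link_sum G x i"
proof -
  have "{e \<in> edges (induced_component G \<alpha>). i \<in> e} = {e \<in> edges G. i \<in> e}"
    using assms edge_in_component by (auto simp: induced_component_def)
  then show ?thesis by (simp add: link_sum_def)
qed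

text \<open>Outside \<open>\<alpha>\<close> both sides of the eigenvalue equation vanish: an edge through such a vertex misses
  \<open>\<alpha>\<close>, and \<open>m - 1 > 0\<close>.\<close>

lemma component_eigenvector_extend:
  assumes \<alpha>: "\<alpha> \<in> component_sets" and x: "x \<in> hg_eigenvectors m (induced_component G \<alpha>) l"
  shows "x \<in> hg_eigenvectors m G l"
proof -
  interpret H: uniform_hg m "induced_component G \<alpha>" by (rule uniform_hg_component) fact
  have x0: "x i = 0" if "i \<notin> \<alpha>" for i using H.eigenvectorsD(3)[OF x] that by simp
  obtain k where k: "k \<in> \<alpha>" "x k \<noteq> 0" using H.eigenvectorsD(2)[OF x] by auto
  show ?thesis
  proof (rule eigenvectorsI)
    fix i assume i: "i \<in> verts G"
    show "link_sum G x i = l * x i ^ (m - 1)"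
    proof (cases "i \<in> \<alpha>")
      case True
      have "link_sum G x i = link_sum (induced_component G \<alpha>) x i"
        by (rule link_sum_component[OF \<alpha> True, symmetric])
      also have "\<dots> = l * x i ^ (m - 1)"
        by (rule H.eigenvectorsD(1)[OF x]) (simp add: True)
      finally show ?thesis .
    next
      case False
      have "link_sum G x i = 0"
        by (rule link_sum_zero) (use False edge_in_component[OF \<alpha>] x0 in blast)
      then show ?thesis using x0[OF False] m2 by (simp add: power_0_left)
    qed
  qed (use k component_subset[OF \<alpha>] x0 in auto)
qed

text \<open>The equation at a vertex of \<open>\<alpha>\<close> involves only edges inside \<open>\<alpha>\<close>.  The vertex \<open>k\<close> guarantees
  that the restriction is not the zero vector.\<close>

lemma component_eigenvector_restrict:
  assumes \<alpha>: "\<alpha> \<in> component_sets" and y: "y \<in> hg_eigenvectors m G l" and k: "k \<in> \<alpha>" "y k \<noteq> 0"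
  shows "(\<lambda>i. if i \<in> \<alpha> then y i else 0) \<in> hg_eigenvectors m (induced_component G \<alpha>) l"
    (is "?y \<in> _")
proof -
  interpret H: uniform_hg m "induced_component G \<alpha>" by (rule uniform_hg_component) fact
  have "link_sum G ?y i = l * ?y i ^ (m - 1)" if i: "i \<in> \<alpha>" for i
  proof -
    have "link_sum G ?y i = link_sum G y i"
      by (rule link_sum_cong) (use i edge_in_component[OF \<alpha>] in auto)
    then show ?thesis using i eigenvectorsD(1)[OF y] component_subset[OF \<alpha>] by auto
  qed
  then show ?thesis
    using k by (intro H.eigenvectorsI[of _ _ k]) (auto simp: link_sum_component[OF \<alpha>])
qed

lemma component_spectral_radius_le:
  assumes \<alpha>: "\<alpha> \<in> component_sets"
  shows "hg_spectral_radius m (induced_component G \<alpha>) \<le> hg_spectral_radius m G"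
proof -
  interpret H: uniform_hg m "induced_component G \<alpha>" by (rule uniform_hg_component) fact
  obtain x where "H.extremal (hg_spectral_radius m (induced_component G \<alpha>)) x"
    by (rule H.extremal_spectral_radius_exists)
  from component_eigenvector_extend[OF \<alpha> H.extremal_eigenvector[OF this]]
  show ?thesis using eigenvector_modulus(1)[OF form_bound_spectral_radius] by fastforce
qed

text \<open>The equation at a vertex sees only one of the two summands, and it is homogeneous.\<close>

lemma component_sum_eigenvector:
  assumes \<alpha>: "\<alpha> \<in> component_sets" and \<beta>: "\<beta> \<in> component_sets" and "\<alpha> \<noteq> \<beta>"
    and x: "x \<in> hg_eigenvectors m (induced_component G \<alpha>) l"
    and y: "y \<in> hg_eigenvectors m (induced_component G \<beta>) l"
  shows "(\<lambda>i. x i + t * y i) \<in> hg_eigenvectors m G l" (is "?z \<in> _")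
proof -
  interpret A: uniform_hg m "induced_component G \<alpha>" by (rule uniform_hg_component) fact
  interpret B: uniform_hg m "induced_component G \<beta>" by (rule uniform_hg_component) fact
  have disj: "\<alpha> \<inter> \<beta> = {}" using components_disjoint[OF \<alpha> \<beta>] assms by blast
  have x0: "x i = 0" if "i \<notin> \<alpha>" for i using A.eigenvectorsD(3)[OF x] that by simp
  have y0: "y i = 0" if "i \<notin> \<beta>" for i using B.eigenvectorsD(3)[OF y] that by simp
  have xG: "link_sum G x i = l * x i ^ (m - 1)" if "i \<in> verts G" for i
    using eigenvectorsD(1)[OF component_eigenvector_extend[OF \<alpha> x] that] .
  have yG: "link_sum G y i = l * y i ^ (m - 1)" if "i \<in> verts G" for i
    using eigenvectorsD(1)[OF component_eigenvector_extend[OF \<beta> y] that] .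
  obtain k where k: "k \<in> \<alpha>" "x k \<noteq> 0" using A.eigenvectorsD(2)[OF x] by auto
  show ?thesis
  proof (rule eigenvectorsI)
    fix i assume i: "i \<in> verts G"
    show "link_sum G ?z i = l * ?z i ^ (m - 1)"
    proof (cases "i \<in> \<beta>")
      case True
      have "link_sum G ?z i = link_sum G (\<lambda>j. t * y j) i"
        by (rule link_sum_cong) (use True edge_in_component[OF \<beta>] disj x0 in auto)
      moreover have "x i = 0" using True disj x0 by blast
      ultimately show ?thesis by (simp add: link_sum_scale yG[OF i] power_mult_distrib)
    next
      case False
      have "link_sum G ?z i = link_sum G x i"
        by (rule link_sum_cong) (use False edge_in_component[OF \<beta>] y0 in auto)
      then show ?thesis using y0[OF False] by (simp add: xG[OF i])
    qed
  next
    show "k \<in> verts G" using k component_subset[OF \<alpha>] by blast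
    have "k \<notin> \<beta>" using k disj by blast
    then show "?z k \<noteq> 0" using k y0 by simp
  next
    fix i assume "i \<notin> verts G"
    then have "i \<notin> \<alpha>" "i \<notin> \<beta>" using component_subset \<alpha> \<beta> by auto
    then show "?z i = 0" using x0 y0 by simp
  qed
qed

lemma spectral_radius_no_edges:
  assumes "edges G = {}" shows "hg_spectral_radius m G = 0"
proof -
  obtain x where x: "extremal (hg_spectral_radius m G) x" by (rule extremal_spectral_radius_exists)
  then obtain k where k: "k \<in> verts G" "x k \<noteq> 0" by (auto simp: extremal_def)
  have "link_sum G x k = 0" using assms by (simp add: link_sum_def)
  then show ?thesis using extremal_link_sum[OF x k(1)] k(2) by simp
qed

text \<open>A component on which some eigenvector for the spectral radius \<open>r\<close> of \<open>G\<close> is nonzero has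
  eigenvalue \<open>r\<close>, hence attains \<open>r\<close>.  So all these eigenvectors are supported on one and the same
  component, to which the finiteness result for the indecomposable case applies.\<close>

lemma unique_radial_component_imp_finite:
  assumes has_edge: "edges G \<noteq> {}"
    and unique: "\<And>\<alpha> \<beta>. \<alpha> \<in> component_sets \<Longrightarrow> \<beta> \<in> component_sets \<Longrightarrow>
      hg_spectral_radius m (induced_component G \<alpha>) = hg_spectral_radius m G \<Longrightarrow>
      hg_spectral_radius m (induced_component G \<beta>) = hg_spectral_radius m G \<Longrightarrow> \<alpha> = \<beta>"
  shows "finite (hg_proj_eigenvariety m G (of_real (hg_spectral_radius m G)))"
proof -
  let ?r = "hg_spectral_radius m G"
  have r: "0 < ?r" by (rule spectral_radius_pos[OF has_edge])
  have full: "hg_spectral_radius m (induced_component G \<alpha>) = ?r"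
    if \<alpha>: "\<alpha> \<in> component_sets" and y: "y \<in> hg_eigenvectors m G (of_real ?r)" and k: "k \<in> \<alpha>" "y k \<noteq> 0"
    for \<alpha> y k
  proof -
    interpret H: uniform_hg m "induced_component G \<alpha>" by (rule uniform_hg_component) fact
    have "cmod (of_real ?r) \<le> hg_spectral_radius m (induced_component G \<alpha>)"
      using H.eigenvector_modulus(1)[OF H.form_bound_spectral_radius
          component_eigenvector_restrict[OF \<alpha> y k]] .
    then show ?thesis using component_spectral_radius_le[OF \<alpha>] r by simp
  qed
  obtain x where "extremal ?r x" by (rule extremal_spectral_radius_exists)
  then have x: "(\<lambda>i. if i \<in> verts G then complex_of_real (x i) else 0) \<in> hg_eigenvectors m G (of_real ?r)"
    (is "?x \<in> _") by (rule extremal_eigenvector)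
  obtain k where k: "k \<in> verts G" "?x k \<noteq> 0" using eigenvectorsD(2)[OF x] by blast
  obtain \<alpha> where \<alpha>: "\<alpha> \<in> component_sets" "k \<in> \<alpha>" using component_of[OF k(1)] by blast
  have r\<alpha>: "hg_spectral_radius m (induced_component G \<alpha>) = ?r" using full[OF \<alpha>(1) x \<alpha>(2) k(2)] .
  interpret H: uniform_hg m "induced_component G \<alpha>" by (rule uniform_hg_component) fact
  have "edges (induced_component G \<alpha>) \<noteq> {}" using H.spectral_radius_no_edges r\<alpha> r by auto
  from H.peripheral_eigenvectors_finite[OF indecomposable_component[OF \<alpha>(1)] this, of "of_real ?r"]
  obtain F where F: "F \<subseteq> hg_eigenvectors m (induced_component G \<alpha>) (of_real ?r)" "finite F"
    "\<forall>x \<in> hg_eigenvectors m (induced_component G \<alpha>) (of_real ?r). \<exists>y\<in>F. \<exists>c. x = (\<lambda>i. c * y i)"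
    using r r\<alpha> by auto
  show ?thesis
  proof (rule eigenvariety_finite)
    show "finite F" by fact
    show "F \<subseteq> hg_eigenvectors m G (of_real ?r)"
      using F(1) component_eigenvector_extend[OF \<alpha>(1)] by blast
    fix y assume y: "y \<in> hg_eigenvectors m G (of_real ?r)"
    have y0: "y i = 0" if "i \<notin> \<alpha>" for i
    proof (rule ccontr)
      assume yi: "y i \<noteq> 0"
      then have "i \<in> verts G" using eigenvectorsD(3)[OF y] by blast
      then obtain \<beta> where \<beta>: "\<beta> \<in> component_sets" "i \<in> \<beta>" using component_of by blast
      then have "\<beta> = \<alpha>" using unique[OF \<beta>(1) \<alpha>(1)] full[OF \<beta>(1) y \<beta>(2) yi] r\<alpha> by blast
      then show False using that \<beta> by blast
    qed
    then have eq: "(\<lambda>i. if i \<in> \<alpha> then y i else 0) = y" by auto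
    obtain j where "j \<in> \<alpha>" "y j \<noteq> 0" using eigenvectorsD(2)[OF y] y0 by blast
    from component_eigenvector_restrict[OF \<alpha>(1) y this]
    have "y \<in> hg_eigenvectors m (induced_component G \<alpha>) (of_real ?r)" by (simp only: eq)
    then show "\<exists>z\<in>F. \<exists>c. y = (\<lambda>i. c * z i)" using F(3) by blast
  qed
qed

end

section \<open>Dimension of subsets of projective space\<close>

text \<open>In a finite \<open>T\<^sub>1\<close> space all subsets are closed, so irreducible sets are singletons and a chain of
  them cannot grow.\<close>

lemma space_dim_finite_t1:
  assumes t1: "t1_space X" and fin: "finite (topspace X)"
  shows "space_dim X \<le> 0"
proof -
  have sing: "\<exists>z. Z = {z}" if Z: "irreducible_in X Z" for Z
  proof -
    have ZX: "Z \<subseteq> topspace X" using Z by (simp add: irreducible_in_def)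
    have cl: "closedin X A" if "A \<subseteq> Z" for A
      using t1 finite_subset[OF _ fin] ZX that by (simp add: t1_space_closedin_finite subset_trans)
    obtain z where z: "z \<in> Z" using Z by (auto simp: irreducible_in_def)
    have "Z \<subseteq> {z} \<or> Z \<subseteq> Z - {z}"
      using Z cl[of "{z}"] cl[of "Z - {z}"] z unfolding irreducible_in_def by blast
    then show ?thesis using z by blast
  qed
  show ?thesis
    unfolding space_dim_def
  proof (rule Sup_least, clarify)
    fix k and Z :: "nat \<Rightarrow> 'a set"
    assume irr: "\<forall>j\<le>k. closedin X (Z j) \<and> irreducible_in X (Z j)" and chain: "\<forall>j<k. Z j \<subset> Z (Suc j)"
    have "k = 0"
    proof (rule ccontr)
      assume "k \<noteq> 0"
      then have "irreducible_in X (Z 0)" "irreducible_in X (Z 1)" "Z 0 \<subset> Z 1"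
        using irr chain by auto
      moreover obtain a where "Z 0 = {a}" using sing[OF \<open>irreducible_in X (Z 0)\<close>] ..
      moreover obtain b where "Z 1 = {b}" using sing[OF \<open>irreducible_in X (Z 1)\<close>] ..
      ultimately show False by auto
    qed
    then show "ereal (real k) \<le> 0" by simp
  qed
qed

lemma space_dim_pos:
  assumes "closedin X A" "irreducible_in X A" "closedin X B" "irreducible_in X B" "A \<subset> B"
  shows "0 < space_dim X"
proof -
  have "ereal (real 1) \<le> space_dim X"
    unfolding space_dim_def
  proof (rule Sup_upper, intro CollectI exI conjI)
    let ?Z = "\<lambda>j::nat. if j = 0 then A else B"
    show "\<forall>j\<le>1. closedin X (?Z j) \<and> irreducible_in X (?Z j)" "\<forall>j<1. ?Z j \<subset> ?Z (Suc j)"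
      using assms by auto
  qed simp
  then show ?thesis by (simp add: less_le_trans[of 0 1] one_ereal_def)
qed

lemma irreducible_in_closure:
  assumes "irreducible_in X Z" shows "irreducible_in X (X closure_of Z)"
proof -
  have Z: "Z \<subseteq> topspace X" "Z \<noteq> {}" using assms by (auto simp: irreducible_in_def)
  have sub: "Z \<subseteq> X closure_of Z" by (rule closure_of_subset) fact
  show ?thesis
    unfolding irreducible_in_def
  proof (intro conjI allI impI)
    fix A B assume AB: "closedin X A \<and> closedin X B \<and> X closure_of Z \<subseteq> A \<union> B"
    then have "Z \<subseteq> A \<or> Z \<subseteq> B" using assms sub unfolding irreducible_in_def by blast
    then show "X closure_of Z \<subseteq> A \<or> X closure_of Z \<subseteq> B"
      using AB closure_of_minimal by metis
  qed (use Z sub closure_of_subset_topspace[of X Z] in auto)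
qed

text \<open>Two finite sets cannot cover the complex plane, so if two closed sets cover the curve, one of
  them contains all of it.\<close>

lemma irreducible_in_range:
  fixes f :: "complex \<Rightarrow> 'b"
  assumes "range f \<subseteq> topspace X"
    and fin: "\<And>C. closedin X C \<Longrightarrow> finite {t. f t \<in> C} \<or> range f \<subseteq> C"
  shows "irreducible_in X (range f)"
  unfolding irreducible_in_def
proof (intro conjI allI impI)
  fix A B assume AB: "closedin X A \<and> closedin X B \<and> range f \<subseteq> A \<union> B"
  show "range f \<subseteq> A \<or> range f \<subseteq> B"
  proof (rule ccontr)
    assume "\<not> ?thesis"
    then have "finite ({t. f t \<in> A} \<union> {t. f t \<in> B})" using AB fin by auto
    moreover have "{t. f t \<in> A} \<union> {t. f t \<in> B} = UNIV" using AB by auto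
    ultimately show False using infinite_UNIV_char_0[where 'a = complex] by simp
  qed
qed (use assms in auto)

lemma closedin_zariski:
  "closedin (zariski I) C \<longleftrightarrow> (\<exists>S \<subseteq> homogeneous_polys I. C = zero_locus I S)"
proof -
  have "zero_locus I S \<subseteq> proj_space I" for S by (auto simp: zero_locus_def)
  then show ?thesis
    by (auto simp: closedin_def topspace_zariski openin_zariski double_diff)
qed

text \<open>Proportionality to \<open>y\<close> is expressed by the vanishing of the \<open>2 \<times> 2\<close> minors
  \<open>y j * X i - y i * X j\<close>.\<close>

lemma closedin_zariski_point:
  assumes y: "y \<in> nonzero_cvecs I"
  shows "closedin (zariski I) {proj_point I y}"
proof -
  define q :: "'a \<Rightarrow> 'a \<Rightarrow> 'a mpoly_c"
    where "q i j = Poly_Mapping.single (Poly_Mapping.single i 1) (y j)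
      + Poly_Mapping.single (Poly_Mapping.single j 1) (- y i)" for i j
  have val: "mpoly_value (q i j) x = y j * x i - y i * x j" for i j x
    by (simp add: q_def mpoly_value_add mpoly_value_single monom_value_def)
  have hom: "q i j \<in> homogeneous_polys I" if "i \<in> I" "j \<in> I" for i j
  proof -
    have "Poly_Mapping.keys (q i j) \<subseteq> {Poly_Mapping.single i 1, Poly_Mapping.single j 1}"
      unfolding q_def by (rule order_trans[OF keys_add]) (auto split: if_splits)
    then have "homogeneous I 1 (q i j)" using that by (fastforce simp: homogeneous_def)
    then show ?thesis by (auto simp: homogeneous_polys_def)
  qed
  let ?S = "{q i j |i j. i \<in> I \<and> j \<in> I}"
  obtain k where k: "k \<in> I" "y k \<noteq> 0"
    using y by (auto simp: nonzero_cvecs_def cvecs_def fun_eq_iff)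
  have "zero_locus I ?S = {proj_point I y}"
  proof (intro equalityI subsetI)
    fix Q assume Q: "Q \<in> zero_locus I ?S"
    then obtain z where z: "z \<in> nonzero_cvecs I" "Q = proj_point I z"
      by (auto simp: zero_locus_def proj_space_eq)
    have "z \<in> Q" unfolding z(2) mem_proj_point[OF z(1)] by (rule exI[of _ 1]) simp
    then have "y k * z i = y i * z k" if "i \<in> I" for i
      using Q that k val[of i k z] by (force simp: zero_locus_def)
    then have "z i = z k / y k * y i" for i
      using k y z by (cases "i \<in> I") (auto simp: nonzero_cvecs_def cvecs_def field_simps)
    then have zy: "z = (\<lambda>i. z k / y k * y i)" by blast
    moreover have "z k / y k \<noteq> 0"
      using z(1) zy by (auto simp: nonzero_cvecs_def)
    ultimately have "proj_point I y = proj_point I z"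
      unfolding proj_point_eq_iff[OF y z(1)] by blast
    then show "Q \<in> {proj_point I y}" using z by simp
  next
    fix Q assume "Q \<in> {proj_point I y}"
    then show "Q \<in> zero_locus I ?S"
      using y by (auto simp: zero_locus_def proj_space_eq mem_proj_point val)
  qed
  moreover have "?S \<subseteq> homogeneous_polys I" using hom by auto
  ultimately show ?thesis unfolding closedin_zariski by (intro exI[of _ ?S]) simp
qed

lemma t1_space_zariski: "t1_space (zariski I)"
  unfolding t1_space_closedin_singleton topspace_zariski proj_space_eq
  using closedin_zariski_point by auto

lemma variety_dim_finite:
  assumes "finite V" shows "variety_dim I V \<le> 0"
  unfolding variety_dim_def
  by (rule space_dim_finite_t1)
    (use assms in \<open>auto simp: t1_space_subtopology t1_space_zariski\<close>)

lemma mpoly_value_on_line: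
  "\<exists>q :: complex poly. \<forall>t. poly q t = mpoly_value p (\<lambda>i. a i + t * b i)"
proof (intro exI allI)
  fix t
  show "poly (\<Sum>s\<in>Poly_Mapping.keys p. smult (Poly_Mapping.lookup p s)
      (\<Prod>i\<in>Poly_Mapping.keys s. [:a i, b i:] ^ Poly_Mapping.lookup s i)) t = mpoly_value p (\<lambda>i. a i + t * b i)"
    by (simp add: mpoly_value_def monom_value_def poly_sum poly_prod)
qed

text \<open>The points \<open>[a + t * b]\<close> form an irreducible set, because a homogeneous polynomial restricted to
  the line is a univariate polynomial in \<open>t\<close>.  Taking the closure of this set in \<open>V\<close> avoids finding
  equations for the line; the chain \<open>{[a]} \<subset> closure\<close> has length one.\<close>

lemma variety_dim_pos_line:
  assumes nz: "\<And>t. (\<lambda>i. a i + t * b i) \<in> nonzero_cvecs I"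
    and V: "\<And>t. proj_point I (\<lambda>i. a i + t * b i) \<in> V"
    and ne: "proj_point I (\<lambda>i. a i + s * b i) \<noteq> proj_point I a"
  shows "0 < variety_dim I V"
proof -
  define X where "X = subtopology (zariski I) V"
  define f where "f t = proj_point I (\<lambda>i. a i + t * b i)" for t
  have anz: "a \<in> nonzero_cvecs I" using nz[of 0] by simp
  have range: "range f \<subseteq> topspace X"
    using nz V by (auto simp: X_def f_def topspace_zariski proj_space_eq)
  have irr: "irreducible_in X (range f)"
  proof (rule irreducible_in_range[OF range])
    fix C assume "closedin X C"
    then obtain S where S: "S \<subseteq> homogeneous_polys I" "C = zero_locus I S \<inter> V"
      by (auto simp: X_def closedin_subtopology closedin_zariski)
    show "finite {t. f t \<in> C} \<or> range f \<subseteq> C"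
    proof (cases "\<forall>p\<in>S. \<forall>t. mpoly_value p (\<lambda>i. a i + t * b i) = 0")
      case True
      have "f t \<in> zero_locus I S" for t
        unfolding zero_locus_def
      proof (intro CollectI conjI ballI)
        show "f t \<in> proj_space I" using nz by (auto simp: f_def proj_space_eq)
        fix p x assume p: "p \<in> S" and "x \<in> f t"
        then obtain c where c: "x = (\<lambda>i. c * (a i + t * b i))"
          by (auto simp: f_def mem_proj_point[OF nz])
        obtain d where "homogeneous I d p" using p S by (auto simp: homogeneous_polys_def)
        then have "mpoly_value p x = c ^ d * mpoly_value p (\<lambda>i. a i + t * b i)"
          unfolding c by (rule mpoly_value_scale)
        then show "mpoly_value p x = 0" using True p by simp
      qed
      then show ?thesis using V S by (auto simp: f_def)
    next
      case False
      then obtain p t0 where p: "p \<in> S" "mpoly_value p (\<lambda>i. a i + t0 * b i) \<noteq> 0" by blast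
      obtain q :: "complex poly" where q: "\<And>t. poly q t = mpoly_value p (\<lambda>i. a i + t * b i)"
        using mpoly_value_on_line by metis
      have "q \<noteq> 0" using p(2) q[of t0] by auto
      then have "finite {t. poly q t = 0}" by (rule poly_roots_finite)
      moreover have "{t. f t \<in> C} \<subseteq> {t. poly q t = 0}"
      proof
        fix t assume "t \<in> {t. f t \<in> C}"
        then have "\<forall>x\<in>f t. mpoly_value p x = 0" using S p(1) by (auto simp: zero_locus_def)
        moreover have "(\<lambda>i. a i + t * b i) \<in> f t"
          unfolding f_def mem_proj_point[OF nz] by (rule exI[of _ 1]) simp
        ultimately show "t \<in> {t. poly q t = 0}" by (simp add: q)
      qed
      ultimately show ?thesis using finite_subset by blast
    qed
  qed
  have f0: "f 0 = proj_point I a" by (simp add: f_def)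
  have sub: "range f \<subseteq> X closure_of range f" by (rule closure_of_subset[OF range])
  show ?thesis
    unfolding variety_dim_def X_def[symmetric]
  proof (rule space_dim_pos)
    have "{f 0} = {proj_point I a} \<inter> V" using V[of 0] f0 by auto
    then show "closedin X {f 0}"
      unfolding X_def closedin_subtopology using closedin_zariski_point[OF anz] by blast
    then show "irreducible_in X {f 0}"
      using closedin_subset[of X "{f 0}"] by (auto simp: irreducible_in_def)
    show "irreducible_in X (X closure_of range f)" by (rule irreducible_in_closure[OF irr])
    have "f s \<in> X closure_of range f" "f s \<noteq> f 0" using sub ne f0 by (auto simp: f_def)
    then show "{f 0} \<subset> X closure_of range f" using sub by auto
  qed simp
qed

section \<open>Components attaining the spectral radius\<close>

context uniform_hg
begin

text \<open>The points \<open>[a]\<close> and \<open>[a + b]\<close> differ, since at a vertex of \<open>\<beta>\<close> where \<open>b\<close> is nonzero, \<open>a\<close> is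
  zero.\<close>

lemma two_radial_components_imp_dim_pos:
  assumes \<alpha>: "\<alpha> \<in> component_sets" and \<beta>: "\<beta> \<in> component_sets" and ne: "\<alpha> \<noteq> \<beta>"
    and "hg_spectral_radius m (induced_component G \<alpha>) = r"
    and "hg_spectral_radius m (induced_component G \<beta>) = r"
  shows "0 < variety_dim (verts G) (hg_proj_eigenvariety m G (of_real r))"
proof -
  interpret A: uniform_hg m "induced_component G \<alpha>" by (rule uniform_hg_component) fact
  interpret B: uniform_hg m "induced_component G \<beta>" by (rule uniform_hg_component) fact
  obtain a where a: "a \<in> hg_eigenvectors m (induced_component G \<alpha>) (of_real r)"
    using A.extremal_spectral_radius_exists A.extremal_eigenvector assms(4) by metis
  obtain b where b: "b \<in> hg_eigenvectors m (induced_component G \<beta>) (of_real r)"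
    using B.extremal_spectral_radius_exists B.extremal_eigenvector assms(5) by metis
  have ev: "(\<lambda>i. a i + t * b i) \<in> hg_eigenvectors m G (of_real r)" for t
    by (rule component_sum_eigenvector[OF \<alpha> \<beta> ne a b])
  then have nz: "(\<lambda>i. a i + t * b i) \<in> nonzero_cvecs (verts G)" for t
    by (auto simp: eigenvectors_def)
  obtain k where k: "k \<in> \<beta>" "b k \<noteq> 0" using B.eigenvectorsD(2)[OF b] by auto
  have "k \<notin> \<alpha>" using components_disjoint[OF \<alpha> \<beta> ne] k by blast
  then have ak: "a k = 0" using A.eigenvectorsD(3)[OF a] by simp
  show ?thesis
  proof (rule variety_dim_pos_line[OF nz])
    show "proj_point (verts G) (\<lambda>i. a i + t * b i) \<in> hg_proj_eigenvariety m G (of_real r)" for t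
      unfolding eigenvariety_eq_image using ev by blast
    have "a \<in> nonzero_cvecs (verts G)" using nz[of 0] by simp
    note iff = proj_point_eq_iff[OF this nz[of 1]]
    show "proj_point (verts G) (\<lambda>i. a i + 1 * b i) \<noteq> proj_point (verts G) a"
    proof
      assume "proj_point (verts G) (\<lambda>i. a i + 1 * b i) = proj_point (verts G) a"
      then obtain c where "(\<lambda>i. a i + 1 * b i) = (\<lambda>i. c * a i)" using iff by metis
      from fun_cong[OF this, of k] show False using k ak by simp
    qed
  qed
qed

text \<open>A component attaining the spectral radius has positive spectral radius, so it contains an edge
  and therefore at least \<open>m \<ge> 2\<close> vertices.\<close>

lemma dim_pos_iff_two_radial_components:
  assumes has_edge: "edges G \<noteq> {}"
  defines "r \<equiv> hg_spectral_radius m G"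
  shows "0 < variety_dim (verts G) (hg_proj_eigenvariety m G (of_real r)) \<longleftrightarrow>
    card {H \<in> hypergraph_components G. card (verts H) \<ge> 2 \<and> hg_spectral_radius m H = r} \<ge> 2"
    (is "?dim \<longleftrightarrow> card ?C \<ge> 2")
proof -
  let ?A = "{\<alpha> \<in> component_sets. hg_spectral_radius m (induced_component G \<alpha>) = r}"
  have "card \<alpha> \<ge> 2" if \<alpha>: "\<alpha> \<in> ?A" for \<alpha>
  proof -
    interpret H: uniform_hg m "induced_component G \<alpha>" by (rule uniform_hg_component) (use \<alpha> in simp)
    have "edges (induced_component G \<alpha>) \<noteq> {}"
      using H.spectral_radius_no_edges spectral_radius_pos[OF has_edge] \<alpha> by (auto simp: r_def)
    then obtain e where e: "e \<in> edges (induced_component G \<alpha>)" by blast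
    have "card e \<le> card \<alpha>" using H.edge_subset[OF e] H.finite_verts by (simp add: card_mono)
    then show ?thesis using H.card_edge[OF e] m2 by simp
  qed
  then have "?C = induced_component G ` ?A"
    by (auto simp: hypergraph_components_def)
  then have card: "card ?C = card ?A" by (simp add: card_image[OF inj_induced_component])
  have finA: "finite ?A" using finite_component_sets by simp
  show ?thesis
  proof (cases "card ?A \<ge> 2")
    case True
    then have "\<not> card ?A \<le> Suc 0" by simp
    then obtain \<alpha> \<beta> where "\<alpha> \<in> ?A" "\<beta> \<in> ?A" "\<alpha> \<noteq> \<beta>"
      unfolding card_le_Suc0_iff_eq[OF finA] by blast
    then have ?dim by (intro two_radial_components_imp_dim_pos[of \<alpha> \<beta>]) auto
    then show ?thesis using True card by simp
  next
    case False
    then have "card ?A \<le> Suc 0" by simp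
    then have "\<forall>\<alpha>\<in>?A. \<forall>\<beta>\<in>?A. \<alpha> = \<beta>" unfolding card_le_Suc0_iff_eq[OF finA] .
    then have "finite (hg_proj_eigenvariety m G (of_real r))"
      unfolding r_def by (intro unique_radial_component_imp_finite[OF has_edge]) blast
    then have "\<not> ?dim" using variety_dim_finite by (simp add: not_less)
    then show ?thesis using False card by simp
  qed
qed

end

theorem theorem6p1:
  fixes m :: nat and G :: "'a hypergraph" and \<rho> :: real
  assumes "m \<ge> 2" and "uniform_hypergraph m G" and "edges G \<noteq> {}"
    and "\<rho> = hg_spectral_radius m G"
  shows "(connected_hypergraph G \<longrightarrow>
      (\<forall>l \<in> hg_eigenvalues m G. cmod l = \<rho> \<longrightarrow> finite (hg_proj_eigenvariety m G l)) \<and>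
      (\<forall>l \<in> hg_eigenvalues m G. \<forall>l' \<in> hg_eigenvalues m G. cmod l = \<rho> \<longrightarrow> cmod l' = \<rho> \<longrightarrow>
         card (hg_proj_eigenvariety m G l) = card (hg_proj_eigenvariety m G l')) \<and>
      (\<forall>l \<in> hg_eigenvalues m G. cmod l = \<rho> \<longrightarrow>
         (\<exists>F \<subseteq> hg_eigenvectors m G l. finite F \<and>
            (\<forall>x \<in> hg_eigenvectors m G l. \<exists>y\<in>F. \<exists>c. x = (\<lambda>i. c * y i))))) \<and>
    (\<not> connected_hypergraph G \<longrightarrow>
      (variety_dim (verts G) (hg_proj_eigenvariety m G (complex_of_real \<rho>)) > 0 \<longleftrightarrow>
       card {H \<in> hypergraph_components G. card (verts H) \<ge> 2 \<and> hg_spectral_radius m H = \<rho>} \<ge> 2))"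
proof -
  interpret uniform_hg m G using assms(1,2) by unfold_locales
  show ?thesis
  proof (intro conjI impI ballI)
    assume "connected_hypergraph G"
    then have ind: "indecomposable G" by (rule connected_indecomposable)
    show "finite (hg_proj_eigenvariety m G l)" if "cmod l = \<rho>" for l
      using peripheral_eigenvariety_finite[OF ind assms(3)] that assms(4) by simp
    show "card (hg_proj_eigenvariety m G l) = card (hg_proj_eigenvariety m G l')"
      if "l \<in> hg_eigenvalues m G" "l' \<in> hg_eigenvalues m G" "cmod l = \<rho>" "cmod l' = \<rho>" for l l'
      using peripheral_eigenvariety_card_le[OF ind assms(3)] that assms(4) by (simp add: order_antisym)
    show "\<exists>F \<subseteq> hg_eigenvectors m G l. finite F \<and>
        (\<forall>x \<in> hg_eigenvectors m G l. \<exists>y\<in>F. \<exists>c. x = (\<lambda>i. c * y i))" if "cmod l = \<rho>" for l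
      using peripheral_eigenvectors_finite[OF ind assms(3)] that assms(4) by simp
  next
    show "0 < variety_dim (verts G) (hg_proj_eigenvariety m G (complex_of_real \<rho>)) \<longleftrightarrow>
        2 \<le> card {H \<in> hypergraph_components G. 2 \<le> card (verts H) \<and> hg_spectral_radius m H = \<rho>}"
      using dim_pos_iff_two_radial_components[OF assms(3)] assms(4) by simp
  qed
qed

end
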